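(* Let $A_1,\dots,A_k\in\mathbb B(\mathfrak H)$ be self-adjoint operators with $\Lambda(A_j)\subset[m_j,M_j]$ for real scalars $m_j<M_j$, let $w=(w_1,\dots,w_k)$ be a probability vector ($\sum_{j=1}^k w_j=1$), and let $\Phi:\mathbb B(\mathfrak H)\to\mathbb B(\mathfrak K)$ be the map $\Phi(X)=V^*\left(\sum_{i=0}^I a_iX^i\right)V$ described in the context. Let $f$ be a real-valued continuous function on $\bigcup_{j=1}^k[m_j,M_j]$ for which there are $\epsilon>0$ and polynomials $p_{\mathcal L},p_{\mathcal U}$ with $0\le p_{\mathcal U}(x)-f(x)\le\epsilon$ and $0\le f(x)-p_{\mathcal L}(x)\le\epsilon$ for all $x\in[\min\Lambda(A_j),\max\Lambda(A_j)]$, $j=1,\dots,k$. Let $\mathrm{Poly}_{f,\mathcal U}(A_j)$, $\mathrm{Poly}_{f,\mathcal L}(A_j)$, $\widetilde{\mathrm{Poly}}_{f,\mathcal U}(m_j,M_j)$, $\widetilde{\mathrm{Poly}}_{f,\mathcal L}(m_j,M_j)$ be as defined in the context, and put $$S_{\mathcal U}=\bigcup_{j=1}^k w_j\widetilde{\mathrm{Poly}}_{f,\mathcal U}(m_j,M_j),\qquad S_{\mathcal L}=\bigcup_{j=1}^k w_j\widetilde{\mathrm{Poly}}_{f,\mathcal L}(m_j,M_j).$$ Let $g$ be a real-valued continuous function defined on $S_{\mathcal L}\cup S_{\mathcal U}$, and let $F(u,v)=u-\alpha v$ ($\alpha\in\mathbb R$) on $J_1\times J_2$, where $f\left(\bigcup_{j=1}^k[m_j,M_j]\right)\subset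 J_1$ and $g(S_{\mathcal L}\cup S_{\mathcal U})\subset J_2$. Then $$\sum_{j=1}^k w_j\Phi(f(A_j))-g\left(\sum_{j=1}^k w_jV^*\mathrm{Poly}_{f,\mathcal U}(A_j)V\right)\le\max_{x\in S_{\mathcal U}}(x-g(x))\,\mathbf 1_{\mathfrak K}$$ and $$\sum_{j=1}^k w_j\Phi(f(A_j))-g\left(\sum_{j=1}^k w_jV^*\mathrm{Poly}_{f,\mathcal L}(A_j)V\right)\ge\min_{x\in S_{\mathcal L}}(x-g(x))\,\mathbf 1_{\mathfrak K}.$$
   Context: $\mathfrak H,\mathfrak K$ are Hilbert spaces, $\mathbb B(\cdot)$ denotes bounded linear operators, $\mathbf 1_{\mathfrak K}$ is the identity of $\mathfrak K$. Inequalities between operators are in the Loewner order. $\Lambda(A)$ is the spectrum of $A$. A function of a self-adjoint operator is taken by functional calculus. The map $\Phi$: $\Phi(X)=V^*\left(\sum_{i=0}^I a_iX^i\right)V$ with real coefficients $a_i$ and $V$ an isometry from $\mathfrak K$ to $\mathfrak H$ ($V^*V=\mathbf 1_{\mathfrak K}$). No linearity, positivity or normalization of $\Phi$ is assumed. $S_{I_+}$ is the set of indices $i\in\{0,\dots,I\}$ with $a_i\ge0$ and $S_{I_-}$ the set of indices with $a_i<0$. Kantorovich function: for $M>m>0$ and $r\in\mathbb R$, $r\ne1$, $$\mathcal K(m,M,r)=\frac{mM^r-Mm^r}{(r-1)(M-m)}\left[\frac{(r-1)(M^r-m^r)}{r(mM^r-Mm^r)}\right]^r,$$ with the values at $r=0$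 and $r=1$ understood as the limits, which equal $1$. $\mathcal K^{-1}$ denotes $1/\mathcal K$. The expressions below presuppose that the arguments of $\mathcal K$ are admissible. For a self-adjoint $A$ and real polynomials $p_{\mathcal L},p_{\mathcal U}$ bounding $f$ from below and above as in the claim, write $\lambda_{\mathcal U}=\min\Lambda(p_{\mathcal U}(A))$, $\mu_{\mathcal U}=\max\Lambda(p_{\mathcal U}(A))$, $\lambda_{\mathcal L}=\min\Lambda(p_{\mathcal L}(A))$, $\mu_{\mathcal L}=\max\Lambda(p_{\mathcal L}(A))$, and define $$\mathrm{Poly}_{f,\mathcal U}(A)=\sum_{i\in S_{I_+}}a_i\,\mathcal K(\lambda_{\mathcal U},\mu_{\mathcal U},i)\,p_{\mathcal U}(A)^i+\sum_{i\in S_{I_-}}a_i\,\mathcal K^{-1}(\lambda_{\mathcal L},\mu_{\mathcal L},i)\,p_{\mathcal L}(A)^i,$$ $$\mathrm{Poly}_{f,\mathcal L}(A)=\sum_{i\in S_{I_+}}a_i\,\mathcal K^{-1}(\lambda_{\mathcal L},\mu_{\mathcal L},i)\,p_{\mathcal L}(A)^i+\sum_{i\in S_{I_-}}a_i\,\mathcal K(\lambda_{\mathcal U},\mu_{\mathcal U},i)\,p_{\mathcal U}(A)^i.$$ Given $\Lambda(A)\subset[m,M]$, $\widetilde{\mathrm{Poly}}_{f,\mathcal U}(m,M)$ (resp. $\widetilde{\mathrm{Poly}}_{f,\mathcal L}(m,M)$) is the value range for the spectrum of $\mathrm{Poly}_{f,\mathcal U}(A)$ (resp. $\mathrm{Poly}_{f,\mathcal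 L}(A)$), i.e. the set of values on $[m,M]$ of the corresponding scalar polynomial (with the coefficients above); for $(m_j,M_j)$ it is formed with $A=A_j$. For a real set $S$, $w_jS=\{w_jx:x\in S\}$.
   Formalization: The first inequality is stated under the added assumption that the spectrum of Σ w_j V*Poly_{f,U}(A_j)V lies in S_U, the second that the spectrum of Σ w_j V*Poly_{f,L}(A_j)V lies in S_L; without these, for k ≥ 2, g of the operator can be undefined or the bound can fail. *)

theory Defs
  imports "HOL-Analysis.Analysis" "HOL-Computational_Algebra.Polynomial"
begin

section \<open>Complex Hilbert spaces\<close>

text \<open>The inner product is conjugate-linear in its first argument.\<close>

class complex_hilbert = banach +
  fixes scaleC :: "complex \<Rightarrow> 'a \<Rightarrow> 'a" (infixr \<open>*\<^sub>C\<close> 75)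
    and cinner :: "'a \<Rightarrow> 'a \<Rightarrow> complex"
  assumes scaleC_add_right: "c *\<^sub>C (x + y) = c *\<^sub>C x + c *\<^sub>C y"
    and scaleC_add_left: "(c + d) *\<^sub>C x = c *\<^sub>C x + d *\<^sub>C x"
    and scaleC_scaleC: "c *\<^sub>C d *\<^sub>C x = (c * d) *\<^sub>C x"
    and scaleR_scaleC: "r *\<^sub>R x = complex_of_real r *\<^sub>C x"
    and cinner_commute: "cinner x y = cnj (cinner y x)"
    and cinner_add_right: "cinner x (y + z) = cinner x y + cinner x z"
    and cinner_scaleC_right: "cinner x (c *\<^sub>C y) = c * cinner x y"
    and cinner_ge_zero: "0 \<le> Re (cinner x x)"
    and cinner_eq_zero_iff: "cinner x x = 0 \<longleftrightarrow> x = 0"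
    and norm_eq_sqrt_cinner: "norm x = sqrt (Re (cinner x x))"

instantiation complex :: complex_hilbert
begin

definition scaleC_complex :: "complex \<Rightarrow> complex \<Rightarrow> complex" where
  "scaleC_complex c x = c * x"

definition cinner_complex :: "complex \<Rightarrow> complex \<Rightarrow> complex" where
  "cinner_complex x y = cnj x * y"

instance
  by standard
    (auto simp: scaleC_complex_def cinner_complex_def algebra_simps scaleR_conv_of_real
      cmod_def power2_eq_square)

end

instantiation prod :: (complex_hilbert, complex_hilbert) complex_hilbert
begin

definition scaleC_prod :: "complex \<Rightarrow> 'a \<times> 'b \<Rightarrow> 'a \<times> 'b" where
  "scaleC_prod c x = (c *\<^sub>C fst x, c *\<^sub>C snd x)"

definition cinner_prod :: "'a \<times> 'b \<Rightarrow> 'a \<times> 'b \<Rightarrow> complex" where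
  "cinner_prod x y = cinner (fst x) (fst y) + cinner (snd x) (snd y)"

instance
proof
  fix x y z :: "'a \<times> 'b" and c d :: complex and r :: real
  show "c *\<^sub>C (x + y) = c *\<^sub>C x + c *\<^sub>C y"
    by (simp add: scaleC_prod_def scaleC_add_right)
  show "(c + d) *\<^sub>C x = c *\<^sub>C x + d *\<^sub>C x"
    by (simp add: scaleC_prod_def scaleC_add_left)
  show "c *\<^sub>C d *\<^sub>C x = (c * d) *\<^sub>C x"
    by (simp add: scaleC_prod_def scaleC_scaleC)
  show "r *\<^sub>R x = complex_of_real r *\<^sub>C x"
    by (simp add: scaleC_prod_def scaleR_prod_def scaleR_scaleC)
  show "cinner x y = cnj (cinner y x)"
    by (simp add: cinner_prod_def cinner_commute[of "fst x"] cinner_commute[of "snd x"])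
  show "cinner x (y + z) = cinner x y + cinner x z"
    by (simp add: cinner_prod_def cinner_add_right)
  show "cinner x (c *\<^sub>C y) = c * cinner x y"
    by (simp add: cinner_prod_def scaleC_prod_def cinner_scaleC_right distrib_left)
  show "0 \<le> Re (cinner x x)"
    by (simp add: cinner_prod_def cinner_ge_zero)
  show n: "norm x = sqrt (Re (cinner x x))"
    by (simp add: cinner_prod_def norm_prod_def norm_eq_sqrt_cinner cinner_ge_zero)
  show "cinner x x = 0 \<longleftrightarrow> x = 0"
  proof
    assume "cinner x x = 0"
    then have "norm x = 0" by (simp add: n)
    then show "x = 0" by simp
  next
    assume "x = 0"
    moreover have "cinner (0::'a) 0 = 0" "cinner (0::'b) 0 = 0"
      by (simp_all only: cinner_eq_zero_iff)
    ultimately show "cinner x x = 0"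
      by (simp add: cinner_prod_def)
  qed
qed

end


section \<open>Bounded operators\<close>

text \<open>
  The library type of bounded linear maps is real-linear; the bounded operators between complex
  Hilbert spaces are its complex-linear elements.
\<close>

definition clinear_op :: "('a::complex_hilbert \<Rightarrow>\<^sub>L 'b::complex_hilbert) \<Rightarrow> bool" where
  "clinear_op T \<longleftrightarrow> (\<forall>c x. T (c *\<^sub>C x) = c *\<^sub>C T x)"

definition adj_op ::
    "('a::complex_hilbert \<Rightarrow>\<^sub>L 'b::complex_hilbert) \<Rightarrow> ('b \<Rightarrow>\<^sub>L 'a)" where
  "adj_op T = (THE S :: 'b \<Rightarrow>\<^sub>L 'a. \<forall>x y. cinner (T x) y = cinner x (S y))"

definition isometry_op :: "('a::complex_hilbert \<Rightarrow>\<^sub>L 'b::complex_hilbert) \<Rightarrow> bool" where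
  "isometry_op V \<longleftrightarrow> clinear_op V \<and> adj_op V o\<^sub>L V = id_blinfun"

definition self_adjoint :: "('a::complex_hilbert \<Rightarrow>\<^sub>L 'a) \<Rightarrow> bool" where
  "self_adjoint T \<longleftrightarrow> clinear_op T \<and> (\<forall>x y. cinner (T x) y = cinner x (T y))"

definition loewner_le ::
    "('a::complex_hilbert \<Rightarrow>\<^sub>L 'a) \<Rightarrow> ('a \<Rightarrow>\<^sub>L 'a) \<Rightarrow> bool" (infix \<open>\<preceq>\<close> 50) where
  "S \<preceq> T \<longleftrightarrow> self_adjoint (T - S) \<and> (\<forall>x. 0 \<le> Re (cinner x ((T - S) x)))"

definition spectrum :: "('a::complex_hilbert \<Rightarrow>\<^sub>L 'a) \<Rightarrow> complex set" where
  "spectrum T = {z. \<not> (\<exists>R. clinear_op R \<and>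
     (\<forall>x. R (T x - z *\<^sub>C x) = x) \<and> (\<forall>x. T (R x) - z *\<^sub>C R x = x))}"

text \<open>
  The spectrum of a self-adjoint operator is a compact set of reals (nonempty unless the space is
  trivial), so that infimum and supremum below are its minimum and maximum.
\<close>

definition spec_min :: "('a::complex_hilbert \<Rightarrow>\<^sub>L 'a) \<Rightarrow> real" where
  "spec_min T = Inf (Re ` spectrum T)"

definition spec_max :: "('a::complex_hilbert \<Rightarrow>\<^sub>L 'a) \<Rightarrow> real" where
  "spec_max T = Sup (Re ` spectrum T)"

primrec pow_op :: "('a::complex_hilbert \<Rightarrow>\<^sub>L 'a) \<Rightarrow> nat \<Rightarrow> ('a \<Rightarrow>\<^sub>L 'a)" where
  "pow_op T 0 = id_blinfun"
| "pow_op T (Suc n) = T o\<^sub>L pow_op T n"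

definition poly_op :: "real poly \<Rightarrow> ('a::complex_hilbert \<Rightarrow>\<^sub>L 'a) \<Rightarrow> ('a \<Rightarrow>\<^sub>L 'a)" where
  "poly_op p T = (\<Sum>i\<le>degree p. coeff p i *\<^sub>R pow_op T i)"

text \<open>
  Continuous functional calculus of a self-adjoint operator: the common norm limit of \<open>p n (T)\<close>
  over all sequences of polynomials \<open>p n\<close> converging to \<open>h\<close> uniformly on the spectrum of \<open>T\<close>.
  It is meaningful when \<open>h\<close> is continuous on the spectrum; values of \<open>h\<close> elsewhere are irrelevant.
\<close>

definition fun_op :: "(real \<Rightarrow> real) \<Rightarrow> ('a::complex_hilbert \<Rightarrow>\<^sub>L 'a) \<Rightarrow> ('a \<Rightarrow>\<^sub>L 'a)" where
  "fun_op h T = (THE B. \<forall>p :: nat \<Rightarrow> real poly.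
     uniform_limit (Re ` spectrum T) (\<lambda>n x. poly (p n) x) h sequentially \<longrightarrow>
     (\<lambda>n. poly_op (p n) T) \<longlonglongrightarrow> B)"


section \<open>The map, the Kantorovich function and the bounding polynomials\<close>

definition Phi ::
    "nat \<Rightarrow> (nat \<Rightarrow> real) \<Rightarrow> ('k::complex_hilbert \<Rightarrow>\<^sub>L 'h::complex_hilbert) \<Rightarrow>
     ('h \<Rightarrow>\<^sub>L 'h) \<Rightarrow> ('k \<Rightarrow>\<^sub>L 'k)" where
  "Phi I a V X = adj_op V o\<^sub>L (\<Sum>i=0..I. a i *\<^sub>R pow_op X i) o\<^sub>L V"

text \<open>The values at \<open>r = 0\<close> and \<open>r = 1\<close> are the limits of the general expression.\<close>

definition kantorovich :: "real \<Rightarrow> real \<Rightarrow> real \<Rightarrow> real" where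
  "kantorovich m M r =
     (if r = 0 \<or> r = 1 then 1
      else (m * M powr r - M * m powr r) / ((r - 1) * (M - m)) *
           (((r - 1) * (M powr r - m powr r)) / (r * (m * M powr r - M * m powr r))) powr r)"

definition idx_pos :: "nat \<Rightarrow> (nat \<Rightarrow> real) \<Rightarrow> nat set" where
  "idx_pos I a = {i\<in>{0..I}. 0 \<le> a i}"

definition idx_neg :: "nat \<Rightarrow> (nat \<Rightarrow> real) \<Rightarrow> nat set" where
  "idx_neg I a = {i\<in>{0..I}. a i < 0}"

definition K_op :: "real poly \<Rightarrow> ('h::complex_hilbert \<Rightarrow>\<^sub>L 'h) \<Rightarrow> nat \<Rightarrow> real" where
  "K_op p A i = kantorovich (spec_min (poly_op p A)) (spec_max (poly_op p A)) (real i)"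

definition Poly_U ::
    "nat \<Rightarrow> (nat \<Rightarrow> real) \<Rightarrow> real poly \<Rightarrow> real poly \<Rightarrow>
     ('h::complex_hilbert \<Rightarrow>\<^sub>L 'h) \<Rightarrow> ('h \<Rightarrow>\<^sub>L 'h)" where
  "Poly_U I a pL pU A =
     (\<Sum>i\<in>idx_pos I a. (a i * K_op pU A i) *\<^sub>R pow_op (poly_op pU A) i) +
     (\<Sum>i\<in>idx_neg I a. (a i * (1 / K_op pL A i)) *\<^sub>R pow_op (poly_op pL A) i)"

definition Poly_L ::
    "nat \<Rightarrow> (nat \<Rightarrow> real) \<Rightarrow> real poly \<Rightarrow> real poly \<Rightarrow>
     ('h::complex_hilbert \<Rightarrow>\<^sub>L 'h) \<Rightarrow> ('h \<Rightarrow>\<^sub>L 'h)" where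
  "Poly_L I a pL pU A =
     (\<Sum>i\<in>idx_pos I a. (a i * (1 / K_op pL A i)) *\<^sub>R pow_op (poly_op pL A) i) +
     (\<Sum>i\<in>idx_neg I a. (a i * K_op pU A i) *\<^sub>R pow_op (poly_op pU A) i)"

text \<open>
  Value ranges on \<open>[m, M]\<close> of the corresponding scalar polynomials; the Kantorovich coefficients
  still come from the operator \<open>A\<close>.
\<close>

definition Range_U ::
    "nat \<Rightarrow> (nat \<Rightarrow> real) \<Rightarrow> real poly \<Rightarrow> real poly \<Rightarrow>
     ('h::complex_hilbert \<Rightarrow>\<^sub>L 'h) \<Rightarrow> real \<Rightarrow> real \<Rightarrow> real set" where
  "Range_U I a pL pU A m M =
     (\<lambda>x. (\<Sum>i\<in>idx_pos I a. a i * K_op pU A i * poly pU x ^ i) +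
          (\<Sum>i\<in>idx_neg I a. a i * (1 / K_op pL A i) * poly pL x ^ i)) ` {m..M}"

definition Range_L ::
    "nat \<Rightarrow> (nat \<Rightarrow> real) \<Rightarrow> real poly \<Rightarrow> real poly \<Rightarrow>
     ('h::complex_hilbert \<Rightarrow>\<^sub>L 'h) \<Rightarrow> real \<Rightarrow> real \<Rightarrow> real set" where
  "Range_L I a pL pU A m M =
     (\<lambda>x. (\<Sum>i\<in>idx_pos I a. a i * (1 / K_op pL A i) * poly pL x ^ i) +
          (\<Sum>i\<in>idx_neg I a. a i * K_op pU A i * poly pU x ^ i)) ` {m..M}"

end

theory Submission
  imports Defs "HOL-Computational_Algebra.Fundamental_Theorem_Algebra"
begin

text \<open>
  The left-hand side is compared with \<open>g(XU)\<close> through the intermediate operator \<open>XU\<close>: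
  \<open>(\<Sum>j. w j * \<Phi>(f(A j))) \<le> XU \<le> g(XU) + max\<close>, where \<open>max\<close> is that of \<open>x - g x\<close> over \<open>SU\<close>.
  The second inequality is the functional calculus of \<open>XU\<close> applied to the scalar inequality
  \<open>x - g x \<le> max\<close> on \<open>SU\<close>, which is assumed to contain the spectrum.  The first one reduces to one
  \<open>A = A j\<close> at a time, since \<open>T \<mapsto> V* T V\<close> and nonnegative combinations respect the Loewner order.
  There \<open>f(A)\<close>, \<open>pL(A)\<close> and \<open>pU(A)\<close> all belong to the calculus of the same operator, so that
  powers are monotone for them and only a scalar inequality on the spectrum of \<open>A\<close> is left:
  from \<open>0 < pL \<le> f \<le> pU\<close> and \<open>K \<ge> 1\<close> one gets \<open>pL^i / K \<le> f^i \<le> K * pU^i\<close>, and the sign of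
  \<open>a i\<close> selects the side to be used (\<open>signed_sum_bounds\<close>).  The lower bound is symmetric, through \<open>XL\<close>.
  Positivity of \<open>pL\<close> on the spectrum is the spectral mapping inclusion
  \<open>poly_in_spec_poly_op\<close> combined with the positive lower end of the spectrum of \<open>pL(A)\<close>, and
  \<open>K \<ge> 1\<close> is Bernoulli's inequality (\<open>kantorovich_ge_1\<close>).

  What carries the proof is therefore the functional calculus, in the form
  \<open>loewner_nonneg_poly_fun_op\<close>: a scalar inequality \<open>0 \<le> r(x) + q(f(x))\<close> on the spectrum passes to
  \<open>0 \<le> r(T) + q(f(T))\<close>.  It rests on the polynomial case \<open>poly_op_nonneg\<close>: a real polynomial that is
  nonnegative on the spectrum of a self-adjoint \<open>T\<close> gives a nonnegative operator.  To see this,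
  factor \<open>p\<close> over the reals.  Quadratic factors \<open>(x - s)^2 + t^2\<close> give coercive, hence invertible,
  operators, and linear factors are invertible off the spectrum; so \<open>p(T)\<close> is invertible as soon as \<open>p\<close>
  has no zero in the spectrum.  Were \<open>p(T)\<close> not nonnegative, the negative infimum \<open>l\<close> of its quadratic
  form would make \<open>p(T) - l\<close> invertible, although it is nonnegative and not bounded below.  Applied to
  \<open>c^2 - p^2\<close>, positivity bounds the norm of \<open>p(T)\<close> by the supremum of \<open>p\<close> on the spectrum, which
  together with Weierstrass approximation makes \<open>fun_op\<close> well defined.

  The adjoint of \<open>V\<close> is given by a definite description, whose existence part is the
  Riesz representation theorem.
\<close>

section \<open>Hilbert space geometry\<close>

lemma cinner_add_left: "cinner (x + y) z = cinner x z + cinner y z"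
  by (metis cinner_commute cinner_add_right complex_cnj_add)

lemma cinner_scaleC_left: "cinner (c *\<^sub>C x) y = cnj c * cinner x y"
  by (metis cinner_commute cinner_scaleC_right complex_cnj_mult)

lemma Re_cinner_commute: "Re (cinner x y) = Re (cinner y x)"
  using cinner_commute[of x y] by simp

lemma Re_cinner_self: "Re (cinner x x) = (norm x)\<^sup>2"
  by (simp add: norm_eq_sqrt_cinner cinner_ge_zero)

lemma norm_scaleC: "norm (c *\<^sub>C x) = norm c * norm x"
proof -
  have "cinner (c *\<^sub>C x) (c *\<^sub>C x) = (cnj c * c) * cinner x x"
    by (simp add: cinner_scaleC_left cinner_scaleC_right)
  also have "cnj c * c = complex_of_real ((norm c)\<^sup>2)"
    by (metis complex_norm_square mult.commute)
  finally have "Re (cinner (c *\<^sub>C x) (c *\<^sub>C x)) = (norm c * norm x)\<^sup>2"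
    by (simp add: Re_cinner_self power_mult_distrib)
  then show ?thesis
    by (simp add: Re_cinner_self)
qed

lemma norm_add_sq: "(norm (x + y))\<^sup>2 = (norm x)\<^sup>2 + 2 * Re (cinner x y) + (norm y)\<^sup>2"
  using Re_cinner_commute[of x y]
  by (simp flip: Re_cinner_self add: cinner_add_left cinner_add_right)

lemma Re_cinner_le: "Re (cinner x y) \<le> norm x * norm y"
proof -
  note norm_add_sq[of x y]
  moreover have "(norm (x + y))\<^sup>2 \<le> (norm x + norm y)\<^sup>2"
    by (intro power_mono norm_triangle_ineq) auto
  ultimately show ?thesis
    by (simp add: power2_sum)
qed

text \<open>The real bound applied to a phase rotation of \<open>y\<close> bounds the modulus.\<close>

lemma cinner_cauchy_schwarz: "norm (cinner x y) \<le> norm x * norm y"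
proof (cases "cinner x y = 0")
  case False
  define c where "c = cnj (sgn (cinner x y))"
  have "norm c = 1"
    using False by (simp add: c_def norm_sgn)
  have "cinner x (c *\<^sub>C y) = complex_of_real (norm (cinner x y))"
  proof -
    have "cinner x (c *\<^sub>C y) = cinner x y * cnj (cinner x y) / norm (cinner x y)"
      by (simp add: c_def cinner_scaleC_right sgn_eq mult.commute)
    also have "\<dots> = complex_of_real ((norm (cinner x y))\<^sup>2 / norm (cinner x y))"
      by (simp only: complex_norm_square of_real_divide)
    finally show ?thesis
      by (simp add: power2_eq_square)
  qed
  then show ?thesis
    using Re_cinner_le[of x "c *\<^sub>C y"] \<open>norm c = 1\<close> by (simp add: norm_scaleC)
qed simp

interpretation scaleC: bounded_bilinear "scaleC :: complex \<Rightarrow> 'a \<Rightarrow> 'a::complex_hilbert"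
proof
  show "\<exists>K. \<forall>a (b::'a). norm (a *\<^sub>C b) \<le> norm a * norm b * K"
    by (rule exI[of _ 1]) (simp add: norm_scaleC)
qed (simp_all add: scaleC_add_left scaleC_add_right scaleR_scaleC[where 'a='a] scaleC_scaleC
       scaleR_conv_of_real mult.commute)

interpretation cinner: bounded_bilinear "cinner :: 'a \<Rightarrow> 'a::complex_hilbert \<Rightarrow> complex"
proof
  show "\<exists>K. \<forall>a b::'a. norm (cinner a b) \<le> norm a * norm b * K"
    by (rule exI[of _ 1]) (simp add: cinner_cauchy_schwarz)
qed (simp_all add: cinner_add_left cinner_add_right scaleR_scaleC[where 'a='a]
       cinner_scaleC_left cinner_scaleC_right scaleR_conv_of_real)

lemma cinner_ext:
  assumes "\<And>z. Re (cinner z x) = Re (cinner z y)"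
  shows "x = y"
proof -
  have "Re (cinner (x - y) (x - y)) = 0"
    using assms[of "x - y"] by (simp add: cinner.diff_right)
  then show ?thesis
    by (simp add: Re_cinner_self)
qed

text \<open>
  Complex-linear functionals are determined by their real parts; this transfers the Riesz
  representation from real to complex functionals.
\<close>

lemma cinner_eqI_Re:
  assumes "\<And>c. Re (c * z) = Re (c * z')"
  shows "z = z'"
  using assms[of 1] assms[of "\<i>"] by (simp add: complex_eq_iff)

lemma norm_diff_sq: "(norm (x - y))\<^sup>2 = (norm x)\<^sup>2 - 2 * Re (cinner x y) + (norm y)\<^sup>2"
  using Re_cinner_commute[of x y]
  by (simp flip: Re_cinner_self add: cinner.diff_left cinner.diff_right)

text \<open>
  The representing vector minimises the energy \<open>J x = |x|^2 - 2 \<phi> x\<close>.  The parallelogram law makes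
  every minimising sequence Cauchy, and the vanishing first variation at the minimiser is the
  representation.
\<close>

lemma riesz_representation_real:
  fixes \<phi> :: "'a::complex_hilbert \<Rightarrow> real"
  assumes "bounded_linear \<phi>"
  shows "\<exists>y. \<forall>x. Re (cinner y x) = \<phi> x"
proof -
  interpret bounded_linear \<phi> by fact
  obtain B where B: "\<And>x. \<bar>\<phi> x\<bar> \<le> norm x * B"
    using bounded by auto
  define J where "J x = (norm x)\<^sup>2 - 2 * \<phi> x" for x
  have J_ge: "- B\<^sup>2 \<le> J x" for x
  proof -
    have "0 \<le> (norm x - B)\<^sup>2" by simp
    then show ?thesis
      using B[of x] by (simp add: J_def power2_diff abs_le_iff)
  qed
  have bdd: "bdd_below (range J)"
    using J_ge by (auto intro!: bdd_belowI)
  define d where "d = (INF x. J x)"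
  have d_le: "d \<le> J x" for x
    unfolding d_def using bdd by (rule cINF_lower) simp
  have "\<exists>x. J x < d + 1 / real (Suc n)" for n
  proof -
    have "Inf (range J) < d + 1 / real (Suc n)"
      by (simp add: d_def)
    then show ?thesis
      by (metis (no_types, lifting) UNIV_I cINF_less_iff UNIV_not_empty bdd)
  qed
  then obtain u where u: "\<And>n. J (u n) < d + 1 / real (Suc n)"
    by metis
  have par: "(norm (x - y))\<^sup>2 \<le> 2 * (J x - d) + 2 * (J y - d)" for x y
  proof -
    have half: "norm ((1/2) *\<^sub>R (x + y)) = norm (x + y) / 2"
      unfolding norm_scaleR by simp
    have "J ((1/2) *\<^sub>R (x + y)) = (norm (x + y))\<^sup>2 / 4 - (\<phi> x + \<phi> y)"
      unfolding J_def half scaleR add by (simp add: power_divide field_simps)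
    with d_le[of "(1/2) *\<^sub>R (x + y)"] show ?thesis
      by (simp add: J_def norm_add_sq norm_diff_sq field_simps)
  qed
  have "Cauchy u"
  proof (rule metric_CauchyI)
    fix e :: real assume "0 < e"
    then obtain N where N: "N > 0" "1 / real N < e\<^sup>2 / 4"
      by (metis divide_pos_pos reals_Archimedean inverse_eq_divide zero_less_numeral
          zero_less_power of_nat_Suc zero_less_Suc)
    have "dist (u i) (u j) < e" if "i \<ge> N" "j \<ge> N" for i j
    proof -
      have "1 / real (Suc i) \<le> 1 / real N" "1 / real (Suc j) \<le> 1 / real N"
        using that N by (auto simp: frac_le)
      then have "J (u i) - d < e\<^sup>2 / 4" "J (u j) - d < e\<^sup>2 / 4"
        using u[of i] u[of j] N(2) by linarith+
      then have "2 * (J (u i) - d) + 2 * (J (u j) - d) < e\<^sup>2"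
        by argo
      with par have "(norm (u i - u j))\<^sup>2 < e\<^sup>2"
        by (rule le_less_trans)
      then show ?thesis
        using \<open>0 < e\<close> by (simp add: dist_norm power_less_imp_less_base)
    qed
    then show "\<exists>N. \<forall>m\<ge>N. \<forall>n\<ge>N. dist (u m) (u n) < e" by blast
  qed
  then obtain y where y: "u \<longlonglongrightarrow> y"
    using Cauchy_convergent_iff convergent_def by blast
  have "J y \<le> d"
  proof (rule LIMSEQ_le)
    show "(\<lambda>n. J (u n)) \<longlonglongrightarrow> J y"
      unfolding J_def by (intro tendsto_intros y tendsto)
    show "(\<lambda>n. d + 1 / real (Suc n)) \<longlonglongrightarrow> d"
      using LIMSEQ_Suc[OF lim_1_over_n] tendsto_add[OF tendsto_const, of _ 0 _ d] by force
    show "\<exists>N. \<forall>n\<ge>N. J (u n) \<le> d + 1 / real (Suc n)"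
      using u less_imp_le by blast
  qed
  then have min: "J y \<le> J x" for x
    using d_le order_trans by blast
  have var: "0 \<le> t\<^sup>2 * (norm h)\<^sup>2 + 2 * t * (Re (cinner y h) - \<phi> h)" for t h
  proof -
    have "J (y + t *\<^sub>R h) = J y + (t\<^sup>2 * (norm h)\<^sup>2 + 2 * t * (Re (cinner y h) - \<phi> h))"
      by (simp add: J_def norm_add_sq cinner.scaleR_right scaleR add power_mult_distrib
          algebra_simps)
    with min[of "y + t *\<^sub>R h"] show ?thesis by simp
  qed
  have "Re (cinner y h) = \<phi> h" for h
  proof -
    define b where "b = Re (cinner y h) - \<phi> h"
    define n where "n = (norm h)\<^sup>2 + 1"
    have "n > 0" by (simp add: n_def add_nonneg_pos)
    \<comment> \<open>For \<open>h \<noteq> 0\<close> the parabola \<open>var\<close> is least at \<open>t = - b / (norm h)^2\<close>; the \<open>1\<close> in \<open>n\<close> covers \<open>h = 0\<close>.\<close>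
    have "0 \<le> (- b / n)\<^sup>2 * n + 2 * (- b / n) * b"
      using var[of "- b / n" h] unfolding b_def[symmetric] n_def
      by (simp add: distrib_left add_increasing2)
    also have "\<dots> = - (b\<^sup>2 / n)"
      using \<open>n > 0\<close> by (simp add: power2_eq_square field_simps)
    finally have "b\<^sup>2 \<le> 0"
      using \<open>n > 0\<close> by (simp add: field_simps)
    then show ?thesis by (simp add: b_def)
  qed
  then show ?thesis by blast
qed

section \<open>Adjoints and invertible operators\<close>

lemma Re_times_cinner: "Re (c * cinner x y) = Re (cinner x (c *\<^sub>C y))"
  by (simp add: cinner_scaleC_right)

text \<open>
  The vector \<open>S y\<close> represents the functional \<open>x \<mapsto> Re (cinner y (T x))\<close>.
\<close>

lemma adjoint_exists:
  fixes T :: "'a::complex_hilbert \<Rightarrow>\<^sub>L 'b::complex_hilbert"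
  assumes T: "clinear_op T"
  shows "\<exists>S :: 'b \<Rightarrow>\<^sub>L 'a. \<forall>x y. cinner (T x) y = cinner x (S y)"
proof -
  have "\<exists>z. \<forall>x. Re (cinner z x) = Re (cinner y (T x))" for y
    by (rule riesz_representation_real)
       (intro bounded_linear_compose[OF bounded_linear_Re]
          bounded_linear_compose[OF cinner.bounded_linear_right] blinfun.bounded_linear_right)
  then obtain S where S: "\<And>y x. Re (cinner (S y) x) = Re (cinner y (T x))"
    by metis
  have adj: "cinner (T x) y = cinner x (S y)" for x y
  proof -
    have "cinner (S y) x = cinner y (T x)"
      by (rule cinner_eqI_Re) (use T in \<open>simp only: Re_times_cinner S clinear_op_def\<close>)
    then show ?thesis
      by (metis cinner_commute)
  qed
  have "bounded_linear S"
  proof (rule bounded_linear_intro)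
    show "S (x + y) = S x + S y" for x y
      by (rule cinner_ext) (simp flip: adj add: cinner.add_right)
    show "S (r *\<^sub>R x) = r *\<^sub>R S x" for r x
      by (rule cinner_ext) (simp flip: adj add: cinner.scaleR_right)
    show "norm (S y) \<le> norm y * norm T" for y
    proof (cases "S y = 0")
      case False
      have "(norm (S y))\<^sup>2 = Re (cinner (T (S y)) y)"
        by (simp add: adj Re_cinner_self)
      also have "\<dots> \<le> norm (T (S y)) * norm y"
        by (rule Re_cinner_le)
      also have "\<dots> \<le> (norm T * norm (S y)) * norm y"
        by (intro mult_right_mono norm_blinfun) auto
      finally show ?thesis
        using False by (simp add: power2_eq_square mult_ac)
    qed simp
  qed
  then show ?thesis
    using adj by (intro exI[of _ "Blinfun S"]) (simp add: bounded_linear_Blinfun_apply)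
qed

lemma cinner_adj_op:
  assumes "clinear_op T"
  shows "cinner (T x) y = cinner x (adj_op T y)"
proof -
  have "\<exists>!S. \<forall>x y. cinner (T x) y = cinner x (blinfun_apply S y)"
  proof (rule ex_ex1I[OF adjoint_exists[OF assms]])
    fix S S' assume "\<forall>x y. cinner (T x) y = cinner x (blinfun_apply S y)"
      "\<forall>x y. cinner (T x) y = cinner x (blinfun_apply S' y)"
    then show "S = S'"
      by (intro blinfun_eqI cinner_ext) metis
  qed
  from theI'[OF this] show ?thesis
    unfolding adj_op_def by blast
qed

lemma blinfun_eq_iff: "S = T \<longleftrightarrow> (\<forall>x. blinfun_apply S x = blinfun_apply T x)"
  by (auto intro: blinfun_eqI)

definition invertible_op :: "('a::complex_hilbert \<Rightarrow>\<^sub>L 'a) \<Rightarrow> bool" where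
  "invertible_op B \<longleftrightarrow>
     (\<exists>R. clinear_op R \<and> R o\<^sub>L B = id_blinfun \<and> B o\<^sub>L R = id_blinfun)"

lemma blinfun_compose_assoc: "(a o\<^sub>L b) o\<^sub>L c = a o\<^sub>L (b o\<^sub>L c)"
  by (rule blinfun_eqI) simp

lemma blinfun_compose_id [simp]: "id_blinfun o\<^sub>L T = T" "T o\<^sub>L id_blinfun = T"
  by (auto intro: blinfun_eqI)

lemma of_real_in_spectrum_iff:
  "complex_of_real r \<in> spectrum T \<longleftrightarrow> \<not> invertible_op (T - r *\<^sub>R id_blinfun)"
  unfolding spectrum_def invertible_op_def
  by (simp add: blinfun_eq_iff blinfun.bilinear_simps scaleR_scaleC)

lemma invertible_op_compose:
  assumes "invertible_op S" "invertible_op T"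
  shows "invertible_op (S o\<^sub>L T)"
proof -
  obtain R Q where "clinear_op R" "R o\<^sub>L S = id_blinfun" "S o\<^sub>L R = id_blinfun"
    and "clinear_op Q" "Q o\<^sub>L T = id_blinfun" "T o\<^sub>L Q = id_blinfun"
    using assms unfolding invertible_op_def by blast
  then show ?thesis
    unfolding invertible_op_def
    by (intro exI[of _ "Q o\<^sub>L R"]) (simp add: blinfun_eq_iff clinear_op_def)
qed

text \<open>
  For commuting factors, composing the inverse of the product with either factor inverts the other
  factor.
\<close>

lemma invertible_op_commuting_factor:
  assumes "invertible_op (S o\<^sub>L T)" and comm: "S o\<^sub>L T = T o\<^sub>L S" and "clinear_op T"
  shows "invertible_op S"
proof -
  obtain R where R: "clinear_op R" "\<And>x. R (S (T x)) = x" "\<And>x. S (T (R x)) = x"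
    using assms(1) unfolding invertible_op_def blinfun_eq_iff by auto
  have comm': "S (T x) = T (S x)" for x
    using comm by (metis blinfun_apply_blinfun_compose)
  have "T (R (S x)) = x" for x
  proof -
    have "T (R (S x)) = R (S (T (T (R (S x)))))" by (simp add: R)
    also have "\<dots> = R (T (S (T (R (S x)))))" by (simp add: comm')
    also have "\<dots> = R (T (S x))" by (simp add: R)
    also have "\<dots> = x" by (metis R(2) comm')
    finally show ?thesis .
  qed
  then show ?thesis
    using R assms(3) unfolding invertible_op_def
    by (intro exI[of _ "T o\<^sub>L R"]) (simp add: blinfun_eq_iff clinear_op_def)
qed

lemma coercive_norm_le:
  assumes "Re (cinner x (y::'a::complex_hilbert)) \<ge> c * (norm x)\<^sup>2"
  shows "c * norm x \<le> norm y"
proof (cases "x = 0")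
  case False
  have "(c * norm x) * norm x \<le> norm y * norm x"
    using assms Re_cinner_le[of x y] by (simp add: power2_eq_square mult_ac)
  then show ?thesis using False by simp
qed simp

text \<open>
  A solution of \<open>B x = y\<close> is a fixed point of \<open>x \<mapsto> x - t (B x - y)\<close>, and coercivity makes this map
  a contraction for small \<open>t > 0\<close>.
\<close>

lemma coercive_imp_invertible_op:
  fixes B :: "'a::complex_hilbert \<Rightarrow>\<^sub>L 'a"
  assumes B: "clinear_op B" and "0 < c"
    and coercive: "\<And>x. c * (norm x)\<^sup>2 \<le> Re (cinner x (B x))"
  shows "invertible_op B"
proof -
  have low: "c * norm x \<le> norm (B x)" for x
    using coercive by (rule coercive_norm_le)
  have inj: "x = y" if "B x = B y" for x y
    using low[of "x - y"] \<open>0 < c\<close> that by (simp add: blinfun.diff_right mult_le_0_iff)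
  \<comment> \<open>\<open>b\<close> dominates both \<open>norm B\<close> and \<open>c\<close>, so that the squared contraction factor \<open>q\<close> is not negative;
    \<open>t\<close> minimises the bound \<open>1 - 2 t c + t^2 b^2\<close> for it.\<close>
  define b where "b = norm B + c"
  have "b > 0" using \<open>0 < c\<close> by (simp add: b_def add_nonneg_pos)
  define t where "t = c / b\<^sup>2"
  have "t > 0" using \<open>0 < c\<close> \<open>b > 0\<close> by (simp add: t_def)
  define q where "q = 1 - c\<^sup>2 / b\<^sup>2"
  have q: "0 \<le> q" "q < 1"
    using \<open>0 < c\<close> \<open>b > 0\<close> by (auto simp: q_def b_def field_simps intro!: power_mono)
  have contr: "(norm (x - t *\<^sub>R B x))\<^sup>2 \<le> q * (norm x)\<^sup>2" for x
  proof -
    have "(norm (B x))\<^sup>2 \<le> (b * norm x)\<^sup>2"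
    proof (rule power_mono)
      show "norm (B x) \<le> b * norm x"
        using norm_blinfun[of B x] \<open>0 < c\<close> by (simp add: b_def distrib_right add_increasing2)
    qed simp
    then have B2: "(norm (B x))\<^sup>2 \<le> b\<^sup>2 * (norm x)\<^sup>2"
      by (simp add: power_mult_distrib)
    have "(norm (x - t *\<^sub>R B x))\<^sup>2 = (norm x)\<^sup>2 - 2 * t * Re (cinner x (B x)) + t\<^sup>2 * (norm (B x))\<^sup>2"
      by (simp add: norm_diff_sq cinner.scaleR_right power_mult_distrib)
    also have "\<dots> \<le> (norm x)\<^sup>2 - 2 * t * (c * (norm x)\<^sup>2) + t\<^sup>2 * (b\<^sup>2 * (norm x)\<^sup>2)"
      using \<open>t > 0\<close> coercive[of x] B2 by (intro add_mono diff_mono mult_left_mono) auto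
    also have "\<dots> = (1 - 2 * (t * c) + t\<^sup>2 * b\<^sup>2) * (norm x)\<^sup>2"
      by (simp add: algebra_simps)
    also have "t\<^sup>2 * b\<^sup>2 = c\<^sup>2 / b\<^sup>2"
      using \<open>b > 0\<close> by (simp add: t_def power2_eq_square)
    also have "t * c = c\<^sup>2 / b\<^sup>2"
      by (simp add: t_def power2_eq_square)
    finally have "(norm (x - t *\<^sub>R B x))\<^sup>2 \<le> (1 - 2 * (c\<^sup>2 / b\<^sup>2) + c\<^sup>2 / b\<^sup>2) * (norm x)\<^sup>2" .
    also have "1 - 2 * (c\<^sup>2 / b\<^sup>2) + c\<^sup>2 / b\<^sup>2 = q"
      by (simp add: q_def)
    finally show ?thesis .
  qed
  have "\<exists>x. B x = y" for y
  proof -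
    have "\<exists>!x. x - t *\<^sub>R (B x - y) = x"
    proof (rule banach_fix_type[of "sqrt q"], use q in simp, use q in simp, intro allI)
      fix u v
      have eq: "u - t *\<^sub>R (B u - y) - (v - t *\<^sub>R (B v - y)) = (u - v) - t *\<^sub>R B (u - v)"
        by (simp add: blinfun.diff_right algebra_simps)
      have "norm ((u - v) - t *\<^sub>R B (u - v)) \<le> sqrt (q * (norm (u - v))\<^sup>2)"
        by (rule real_le_rsqrt[OF contr])
      also have "\<dots> = sqrt q * norm (u - v)"
        by (simp add: real_sqrt_mult)
      finally show "dist (u - t *\<^sub>R (B u - y)) (v - t *\<^sub>R (B v - y)) \<le> sqrt q * dist u v"
        unfolding dist_norm eq .
    qed
    then show ?thesis using \<open>t > 0\<close> by auto
  qed
  then obtain R where R: "\<And>y. B (R y) = y" by metis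
  have "bounded_linear R"
  proof (rule bounded_linear_intro)
    show "R (x + y) = R x + R y" for x y
      by (rule inj) (simp add: R blinfun.add_right)
    show "R (r *\<^sub>R x) = r *\<^sub>R R x" for r x
      by (rule inj) (simp add: R blinfun.scaleR_right)
    show "norm (R y) \<le> norm y * (1 / c)" for y
      using low[of "R y"] \<open>0 < c\<close> by (simp add: R field_simps)
  qed
  moreover have "R (c *\<^sub>C x) = c *\<^sub>C R x" for c x
    by (rule inj) (use B in \<open>simp add: R clinear_op_def\<close>)
  moreover have "R (B x) = x" for x
    by (rule inj) (simp add: R)
  ultimately show ?thesis
    unfolding invertible_op_def blinfun_eq_iff clinear_op_def
    by (intro exI[of _ "Blinfun R"]) (simp add: bounded_linear_Blinfun_apply R)
qed

section \<open>Polynomials of an operator\<close>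

interpretation blinfun_compose: bounded_bilinear
  "(o\<^sub>L) :: ('b::real_normed_vector \<Rightarrow>\<^sub>L 'c::real_normed_vector) \<Rightarrow>
     ('a::real_normed_vector \<Rightarrow>\<^sub>L 'b) \<Rightarrow> ('a \<Rightarrow>\<^sub>L 'c)"
  by (rule bounded_bilinear_blinfun_compose)

lemma poly_op_altdef:
  assumes "degree p \<le> n"
  shows "poly_op p T = (\<Sum>i\<le>n. coeff p i *\<^sub>R pow_op T i)"
  unfolding poly_op_def
  by (rule sum.mono_neutral_left) (use assms in \<open>auto simp: coeff_eq_0\<close>)

lemma poly_op_0 [simp]: "poly_op 0 T = 0"
  by (simp add: poly_op_def)

lemma poly_op_pCons [simp]: "poly_op (pCons c p) T = c *\<^sub>R id_blinfun + (T o\<^sub>L poly_op p T)"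
proof -
  have "poly_op (pCons c p) T =
      (\<Sum>i\<le>Suc (degree p). coeff (pCons c p) i *\<^sub>R pow_op T i)"
    by (rule poly_op_altdef) (rule degree_pCons_le)
  then show ?thesis
    unfolding sum.atMost_Suc_shift
    by (simp del: degree_pCons_eq_if add: poly_op_def blinfun_compose.sum_right blinfun_compose.scaleR_right)
qed

lemma poly_op_add: "poly_op (p + q) T = poly_op p T + poly_op q T"
proof -
  let ?n = "max (degree p) (degree q)"
  have "poly_op (p + q) T = (\<Sum>i\<le>?n. coeff (p + q) i *\<^sub>R pow_op T i)"
    by (rule poly_op_altdef) (rule degree_add_le_max)
  then show ?thesis
    by (simp add: poly_op_altdef[of p ?n] poly_op_altdef[of q ?n] scaleR_left.add sum.distrib)
qed

lemma poly_op_smult: "poly_op (smult c p) T = c *\<^sub>R poly_op p T"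
proof -
  have "poly_op (smult c p) T = (\<Sum>i\<le>degree p. coeff (smult c p) i *\<^sub>R pow_op T i)"
    by (rule poly_op_altdef) simp
  then show ?thesis
    by (simp add: poly_op_def scaleR_sum_right)
qed

lemma poly_op_diff: "poly_op (p - q) T = poly_op p T - poly_op q T"
  using poly_op_add[of "p - q" q T] by simp

lemma poly_op_minus: "poly_op (- p) T = - poly_op p T"
  using poly_op_diff[of 0 p T] by simp

lemma poly_op_monom: "poly_op (monom c i) T = c *\<^sub>R pow_op T i"
proof (induction i)
  case (Suc i)
  then show ?case
    by (simp add: monom_Suc blinfun_compose.scaleR_right)
qed (simp add: monom_0)

lemma poly_op_sum: "poly_op (\<Sum>i\<in>S. p i) T = (\<Sum>i\<in>S. poly_op (p i) T)"
  by (induction S rule: infinite_finite_induct) (auto simp: poly_op_add)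

lemma poly_op_mult: "poly_op (p * q) T = poly_op p T o\<^sub>L poly_op q T"
  by (induction p)
     (simp_all add: poly_op_add poly_op_smult blinfun_compose.add_left
        blinfun_compose.scaleR_left blinfun_compose_assoc)

lemma poly_op_power: "poly_op (p ^ i) T = pow_op (poly_op p T) i"
  by (induction i) (simp_all add: poly_op_mult one_pCons)

lemma poly_op_commute: "poly_op p T o\<^sub>L poly_op q T = poly_op q T o\<^sub>L poly_op p T"
  by (metis mult.commute poly_op_mult)

lemma tendsto_poly_op:
  assumes "S \<longlonglongrightarrow> B"
  shows "(\<lambda>n. poly_op q (S n)) \<longlonglongrightarrow> poly_op q B"
proof (induction q)
  case (pCons c q)
  then show ?case
    by (simp add: tendsto_add blinfun_compose.tendsto[OF assms])
qed simp

lemma poly_op_pcompose: "poly_op (pcompose q p) T = poly_op q (poly_op p T)"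
  by (induction q) (simp_all add: pcompose_pCons poly_op_add poly_op_mult)

section \<open>Self-adjoint operators and the Loewner order\<close>

lemma clinear_op_closed:
  "clinear_op id_blinfun"
  "clinear_op S \<Longrightarrow> clinear_op T \<Longrightarrow> clinear_op (S + T)"
  "clinear_op S \<Longrightarrow> clinear_op T \<Longrightarrow> clinear_op (S - T)"
  "clinear_op S \<Longrightarrow> clinear_op (r *\<^sub>R S)"
  "clinear_op S \<Longrightarrow> clinear_op S' \<Longrightarrow> clinear_op (S o\<^sub>L S')"
  by (auto simp: clinear_op_def blinfun.bilinear_simps scaleC_add_right scaleC.diff_right
      scaleC_scaleC scaleR_scaleC mult.commute)

lemma self_adjoint_closed:
  "self_adjoint 0"
  "self_adjoint id_blinfun"
  "self_adjoint S \<Longrightarrow> self_adjoint T \<Longrightarrow> self_adjoint (S + T)"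
  "self_adjoint S \<Longrightarrow> self_adjoint T \<Longrightarrow> self_adjoint (S - T)"
  "self_adjoint S \<Longrightarrow> self_adjoint (r *\<^sub>R S)"
  by (auto simp: self_adjoint_def clinear_op_closed blinfun.bilinear_simps cinner.add_left
      cinner.add_right cinner.diff_left cinner.diff_right cinner.scaleR_left cinner.scaleR_right
      cinner.zero_left cinner.zero_right clinear_op_def scaleC.zero_right
      scaleC_add_right scaleC.diff_right scaleC_scaleC scaleR_scaleC mult.commute
      cinner_scaleC_left cinner_scaleC_right)

lemma self_adjoint_sum: "(\<And>i. i \<in> S \<Longrightarrow> self_adjoint (T i)) \<Longrightarrow> self_adjoint (\<Sum>i\<in>S. T i)"
  by (induction S rule: infinite_finite_induct) (auto simp: self_adjoint_closed)

lemma self_adjoint_compose: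
  assumes "self_adjoint S" "self_adjoint T" "S o\<^sub>L T = T o\<^sub>L S"
  shows "self_adjoint (S o\<^sub>L T)"
proof -
  have "S (T x) = T (S x)" for x
    using assms(3) by (metis blinfun_apply_blinfun_compose)
  then show ?thesis
    using assms(1,2) by (auto simp: self_adjoint_def clinear_op_closed)
qed

lemma self_adjoint_poly_op:
  assumes "self_adjoint T"
  shows "self_adjoint (poly_op p T)"
proof (induction p)
  case (pCons c p)
  have "poly_op [:0, 1:] T = T" by simp
  then have "T o\<^sub>L poly_op p T = poly_op p T o\<^sub>L T"
    using poly_op_commute[of "[:0, 1:]" T p] by metis
  with pCons assms show ?case
    by (simp add: self_adjoint_closed self_adjoint_compose)
qed (simp add: self_adjoint_closed)

lemma self_adjoint_limit:
  assumes "\<And>n. self_adjoint (T n)" "T \<longlonglongrightarrow> S"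
  shows "self_adjoint S"
proof -
  have lim: "(\<lambda>n. T n x) \<longlonglongrightarrow> S x" for x
    by (intro tendsto_intros assms)
  have "S (c *\<^sub>C x) = c *\<^sub>C S x" for c x
  proof (rule LIMSEQ_unique[OF lim])
    show "(\<lambda>n. T n (c *\<^sub>C x)) \<longlonglongrightarrow> c *\<^sub>C S x"
      using scaleC.tendsto[OF tendsto_const lim] assms(1)
      by (simp add: self_adjoint_def clinear_op_def)
  qed
  moreover have "cinner (S x) y = cinner x (S y)" for x y
  proof (rule LIMSEQ_unique)
    show "(\<lambda>n. cinner (T n x) y) \<longlonglongrightarrow> cinner (S x) y"
      by (intro cinner.tendsto lim tendsto_const)
    show "(\<lambda>n. cinner (T n x) y) \<longlonglongrightarrow> cinner x (S y)"
      using cinner.tendsto[OF tendsto_const lim] assms(1) by (simp add: self_adjoint_def)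
  qed
  ultimately show ?thesis
    by (simp add: self_adjoint_def clinear_op_def)
qed

lemma zero_loewner_le_iff: "0 \<preceq> T \<longleftrightarrow> self_adjoint T \<and> (\<forall>x. 0 \<le> Re (cinner x (T x)))"
  by (simp add: loewner_le_def)

lemma loewner_le_iff_diff: "S \<preceq> T \<longleftrightarrow> 0 \<preceq> T - S"
  by (simp add: loewner_le_def)

lemma loewner_nonneg_add: "0 \<preceq> S \<Longrightarrow> 0 \<preceq> T \<Longrightarrow> 0 \<preceq> S + T"
  by (simp add: zero_loewner_le_iff self_adjoint_closed blinfun.add_left cinner.add_right)

lemma loewner_le_trans: "R \<preceq> S \<Longrightarrow> S \<preceq> T \<Longrightarrow> R \<preceq> T"
  unfolding loewner_le_iff_diff[of R] loewner_le_iff_diff[of S]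
  using loewner_nonneg_add[of "S - R" "T - S"] by simp

lemma loewner_nonneg_scaleR: "0 \<preceq> T \<Longrightarrow> 0 \<le> r \<Longrightarrow> 0 \<preceq> r *\<^sub>R T"
  by (simp add: zero_loewner_le_iff self_adjoint_closed blinfun.scaleR_left cinner.scaleR_right)

lemma loewner_nonneg_sum: "(\<And>i. i \<in> S \<Longrightarrow> 0 \<preceq> T i) \<Longrightarrow> 0 \<preceq> (\<Sum>i\<in>S. T i)"
proof (induction S rule: infinite_finite_induct)
  case (insert x F)
  then show ?case by (simp add: loewner_nonneg_add)
qed (simp_all add: zero_loewner_le_iff self_adjoint_closed cinner.zero_right)

lemma loewner_add_right: "S \<preceq> T \<Longrightarrow> S + R \<preceq> T + R"
  by (simp add: loewner_le_def)

lemma loewner_sum_mono: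
  assumes "\<And>j. j \<in> S \<Longrightarrow> 0 \<le> w j" "\<And>j. j \<in> S \<Longrightarrow> R j \<preceq> T j"
  shows "(\<Sum>j\<in>S. w j *\<^sub>R R j) \<preceq> (\<Sum>j\<in>S. w j *\<^sub>R T j)"
proof -
  have "0 \<preceq> (\<Sum>j\<in>S. w j *\<^sub>R (T j - R j))"
    using assms by (intro loewner_nonneg_sum loewner_nonneg_scaleR) (simp_all flip: loewner_le_iff_diff)
  then show ?thesis
    by (subst loewner_le_iff_diff) (simp add: scaleR_diff_right sum_subtractf)
qed

lemma loewner_nonneg_limit:
  assumes "\<And>n. 0 \<preceq> T n" "T \<longlonglongrightarrow> S"
  shows "0 \<preceq> S"
proof -
  have "0 \<le> Re (cinner x (S x))" for x
  proof (rule LIMSEQ_le_const)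
    show "(\<lambda>n. Re (cinner x (T n x))) \<longlonglongrightarrow> Re (cinner x (S x))"
      by (intro tendsto_intros cinner.tendsto assms)
    show "\<exists>N. \<forall>n\<ge>N. 0 \<le> Re (cinner x (T n x))"
      using assms(1) by (auto simp: zero_loewner_le_iff)
  qed
  moreover have "self_adjoint S"
    by (rule self_adjoint_limit[OF _ assms(2)]) (use assms(1) in \<open>simp add: zero_loewner_le_iff\<close>)
  ultimately show ?thesis
    by (simp add: zero_loewner_le_iff)
qed

lemma cinner_adj_op_right:
  assumes "clinear_op V"
  shows "cinner x (adj_op V y) = cinner (V x) y" "cinner (adj_op V y) x = cinner y (V x)"
  using cinner_adj_op[OF assms, of x y] by (metis cinner_commute)+

lemma self_adjoint_congruence:
  assumes V: "clinear_op V" and T: "self_adjoint T"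
  shows "self_adjoint (adj_op V o\<^sub>L T o\<^sub>L V)"
proof -
  have "clinear_op (adj_op V)"
    unfolding clinear_op_def
    by (intro allI cinner_ext)
       (simp add: cinner_adj_op_right[OF V] cinner_scaleC_right)
  then show ?thesis
    using V T by (simp add: self_adjoint_def clinear_op_closed cinner_adj_op_right)
qed

lemma loewner_nonneg_congruence:
  assumes "clinear_op V" "0 \<preceq> T"
  shows "0 \<preceq> adj_op V o\<^sub>L T o\<^sub>L V"
  using assms by (simp add: zero_loewner_le_iff self_adjoint_congruence cinner_adj_op_right)

section \<open>Spectral mapping and positivity\<close>

text \<open>
  The real points of the spectrum: these are the ones that linear factors of a real polynomial test.
\<close>

abbreviation spec :: "('a::complex_hilbert \<Rightarrow>\<^sub>L 'a) \<Rightarrow> real set" where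
  "spec T \<equiv> {r. complex_of_real r \<in> spectrum T}"

lemma poly_map_of_real_pCons:
  "poly (map_poly complex_of_real (pCons a p)) z = a + z * poly (map_poly complex_of_real p) z"
  by (simp add: map_poly_pCons)

lemma poly_map_of_real_add:
  "poly (map_poly complex_of_real (p + q)) z =
     poly (map_poly complex_of_real p) z + poly (map_poly complex_of_real q) z"
  by (induction p q rule: poly_induct2) (simp_all add: poly_map_of_real_pCons algebra_simps)

lemma poly_map_of_real_smult:
  "poly (map_poly complex_of_real (smult c p)) z = c * poly (map_poly complex_of_real p) z"
  by (induction p) (simp_all add: poly_map_of_real_pCons algebra_simps)

lemma poly_map_of_real_mult:
  "poly (map_poly complex_of_real (p * q)) z =
     poly (map_poly complex_of_real p) z * poly (map_poly complex_of_real q) z"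
  by (induction p)
     (simp_all add: poly_map_of_real_pCons poly_map_of_real_add poly_map_of_real_smult algebra_simps)

lemma poly_map_of_real_of_real:
  "poly (map_poly complex_of_real p) (complex_of_real r) = complex_of_real (poly p r)"
  by (induction p) (simp_all add: poly_map_of_real_pCons)

text \<open>
  A root of the complexification is either real, giving a linear factor, or nonreal, and then its
  minimal polynomial over the reals divides the polynomial.
\<close>

lemma real_poly_factor_cases:
  fixes p :: "real poly"
  assumes "degree p > 0"
  obtains r q where "p = [:- r, 1:] * q"
    | s t q where "t \<noteq> 0" "p = ([:- s, 1:]\<^sup>2 + [:t\<^sup>2:]) * q"
proof -
  let ?c = "map_poly complex_of_real"
  have "degree (?c p) = degree p"
    by (rule degree_map_poly) simp
  then have "\<not> constant (poly (?c p))"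
    using assms by (simp add: constant_degree)
  then obtain z where z: "poly (?c p) z = 0"
    using fundamental_theorem_of_algebra by blast
  show thesis
  proof (cases "Im z = 0")
    case True
    then have "z = complex_of_real (Re z)"
      by (simp add: complex_eq_iff)
    then have "poly p (Re z) = 0"
      using z poly_map_of_real_of_real[of p "Re z"] by simp
    then have "[:- Re z, 1:] dvd p"
      by (simp add: poly_eq_0_iff_dvd)
    then show thesis
      using that(1) by (auto elim: dvdE)
  next
    case False
    define d where "d = [:- Re z, 1:]\<^sup>2 + [:(Im z)\<^sup>2:]"
    have d_eq: "d = [:(Re z)\<^sup>2 + (Im z)\<^sup>2, - 2 * Re z, 1:]"
      by (simp add: d_def power2_eq_square)
    have "poly (?c d) z = 0"
      by (simp add: d_eq poly_map_of_real_pCons complex_eq_iff power2_eq_square algebra_simps)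
    define e where "e = p mod d"
    have p: "p = d * (p div d) + e"
      by (simp add: e_def)
    have "poly (?c e) z = 0"
      using z \<open>poly (?c d) z = 0\<close> by (subst (asm) p) (simp add: poly_map_of_real_add poly_map_of_real_mult)
    have "e = 0 \<or> degree e < 2"
      unfolding e_def using degree_mod_less[of d p] by (simp add: d_eq numeral_2_eq_2)
    then have "degree e \<le> 1" by auto
    obtain u e' where e': "e = pCons u e'"
      by (cases e)
    with \<open>degree e \<le> 1\<close> have "degree e' = 0"
      by (simp add: degree_pCons_eq_if split: if_splits)
    then obtain v where uv: "e = [:u, v:]"
      using e' by (metis degree_eq_zeroE)
    have "u = 0 \<and> v = 0"
      using \<open>poly (?c e) z = 0\<close> False
      by (auto simp: uv poly_map_of_real_pCons complex_eq_iff)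
    then have "p = d * (p div d)"
      using p by (simp add: uv)
    then show thesis
      using that(2)[of "Im z" "Re z" "p div d"] False by (simp add: d_def)
  qed
qed

lemma poly_op_linear: "poly_op [:- r, 1:] T = T - r *\<^sub>R id_blinfun"
  by simp

text \<open>
  Strong induction over the real factorisation.  A factor with a nonreal root is
  \<open>(T - s)^2 + t^2\<close>, whose quadratic form is \<open>|(T - s) x|^2 + t^2 |x|^2\<close> and hence coercive.
\<close>

lemma invertible_poly_op:
  assumes T: "self_adjoint T"
  shows "p \<noteq> 0 \<Longrightarrow> (\<And>r. r \<in> spec T \<Longrightarrow> poly p r \<noteq> 0) \<Longrightarrow> invertible_op (poly_op p T)"
proof (induction "degree p" arbitrary: p rule: less_induct)
  case less
  show ?case
  proof (cases "degree p = 0")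
    case True
    then obtain c where c: "p = [:c:]" "c \<noteq> 0"
      using less.prems by (metis degree_eq_zeroE pCons_0_0)
    then show ?thesis
      unfolding invertible_op_def
      by (intro exI[of _ "inverse c *\<^sub>R id_blinfun"])
         (simp add: clinear_op_closed blinfun_compose.scaleR_left blinfun_compose.scaleR_right)
  next
    case False
    then have "degree p > 0" by simp
    then show ?thesis
    proof (cases rule: real_poly_factor_cases)
      case (1 r q)
      have "q \<noteq> 0" using 1 less.prems(1) by auto
      have "invertible_op (poly_op q T)"
      proof (rule less.hyps)
        show "degree q < degree p"
          using \<open>q \<noteq> 0\<close> by (simp add: 1 degree_mult_eq del: mult_pCons_left)
        show "poly q x \<noteq> 0" if "x \<in> spec T" for x
          using less.prems(2)[OF that] by (simp add: 1)
      qed fact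
      moreover have "r \<notin> spec T"
        using less.prems(2)[of r] by (auto simp: 1)
      ultimately show ?thesis
        unfolding 1 poly_op_mult poly_op_linear
        by (intro invertible_op_compose) (simp_all add: of_real_in_spectrum_iff)
    next
      case (2 s t q)
      have "q \<noteq> 0" using 2 less.prems(1) by auto
      have "invertible_op (poly_op q T)"
      proof (rule less.hyps)
        have "[:- s, 1:]\<^sup>2 + [:t\<^sup>2:] = [:s\<^sup>2 + t\<^sup>2, - 2 * s, 1:]"
          by (simp add: power2_eq_square)
        then show "degree q < degree p"
          using \<open>q \<noteq> 0\<close> by (simp add: 2 degree_mult_eq del: mult_pCons_left)
        show "poly q x \<noteq> 0" if "x \<in> spec T" for x
          using less.prems(2)[OF that] by (simp add: 2)
      qed fact
      moreover have "invertible_op (poly_op ([:- s, 1:]\<^sup>2 + [:t\<^sup>2:]) T)"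
      proof (rule coercive_imp_invertible_op)
        let ?S = "poly_op [:- s, 1:] T"
        have sa: "self_adjoint (poly_op p T)" for p
          using T by (rule self_adjoint_poly_op)
        from sa show "clinear_op (poly_op ([:- s, 1:]\<^sup>2 + [:t\<^sup>2:]) T)"
          by (simp add: self_adjoint_def)
        show "0 < t\<^sup>2" using 2 by simp
        fix x
        have "poly_op ([:- s, 1:]\<^sup>2 + [:t\<^sup>2:]) T x = ?S (?S x) + t\<^sup>2 *\<^sub>R x"
          by (simp only: poly_op_add power2_eq_square[of "[:- s, 1:]"] poly_op_mult)
             (simp add: blinfun.bilinear_simps)
        then have "Re (cinner x (poly_op ([:- s, 1:]\<^sup>2 + [:t\<^sup>2:]) T x)) =
            (norm (?S x))\<^sup>2 + t\<^sup>2 * (norm x)\<^sup>2"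
          using sa[of "[:- s, 1:]"]
          by (simp only: self_adjoint_def cinner.add_right cinner.scaleR_right)
             (simp add: Re_cinner_self flip: Re_cinner_self)
        then show "t\<^sup>2 * (norm x)\<^sup>2 \<le> Re (cinner x (poly_op ([:- s, 1:]\<^sup>2 + [:t\<^sup>2:]) T x))"
          by simp
      qed
      ultimately show ?thesis
        unfolding 2 poly_op_mult by (intro invertible_op_compose)
    qed
  qed
qed

text \<open>
  The linear factor \<open>T - r\<close> divides \<open>p(T) - p(r)\<close> and commutes with the cofactor, so it would inherit
  invertibility.
\<close>

lemma poly_in_spec_poly_op:
  assumes T: "self_adjoint T" and r: "r \<in> spec T"
  shows "poly p r \<in> spec (poly_op p T)"
proof -
  have "[:- r, 1:] dvd p - [:poly p r:]"
    by (simp add: poly_eq_0_iff_dvd[symmetric])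
  then obtain q where q: "p - [:poly p r:] = [:- r, 1:] * q"
    by (auto elim: dvdE)
  have eq: "poly_op p T - poly p r *\<^sub>R id_blinfun = poly_op [:- r, 1:] T o\<^sub>L poly_op q T"
    using arg_cong[OF q, of "\<lambda>p. poly_op p T"] by (simp only: poly_op_diff poly_op_mult) simp
  have "\<not> invertible_op (poly_op [:- r, 1:] T o\<^sub>L poly_op q T)"
  proof
    assume "invertible_op (poly_op [:- r, 1:] T o\<^sub>L poly_op q T)"
    then have "invertible_op (poly_op [:- r, 1:] T)"
      by (rule invertible_op_commuting_factor)
         (use self_adjoint_poly_op[OF T, of q] in \<open>auto simp only: poly_op_commute self_adjoint_def\<close>)
    with r show False
      by (simp add: of_real_in_spectrum_iff)
  qed
  then show ?thesis
    by (simp add: of_real_in_spectrum_iff eq)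
qed

text \<open>
  Expand the nonnegative number \<open>cinner y (B y)\<close> at \<open>y = x - s B x\<close> with \<open>s = 1 / b\<close>.  The estimate turns
  a small value of the quadratic form into a small \<open>B x\<close>.
\<close>

lemma nonneg_norm_sq_le:
  assumes "0 \<preceq> B" "norm B \<le> b" "0 < b"
  shows "(norm (B x))\<^sup>2 \<le> b * Re (cinner x (B x))"
proof -
  have sa: "cinner (B u) v = cinner u (B v)" for u v
    using assms(1) by (simp add: zero_loewner_le_iff self_adjoint_def)
  define s where "s = 1 / b"
  have "s > 0" using \<open>0 < b\<close> by (simp add: s_def)
  have "0 \<le> Re (cinner (x - s *\<^sub>R B x) (B (x - s *\<^sub>R B x)))"
    using assms(1) by (simp add: zero_loewner_le_iff)
  also have "\<dots> = Re (cinner x (B x)) - 2 * s * (norm (B x))\<^sup>2 + s\<^sup>2 * Re (cinner (B x) (B (B x)))"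
    by (simp add: blinfun.diff_right blinfun.scaleR_right cinner.diff_left cinner.diff_right
        cinner.scaleR_left cinner.scaleR_right sa[of x "B x", symmetric] Re_cinner_self[symmetric] power2_eq_square[of s]
        algebra_simps)
  also have "Re (cinner (B x) (B (B x))) \<le> norm (B x) * norm (B (B x))"
    by (rule Re_cinner_le)
  also have "\<dots> \<le> norm (B x) * (b * norm (B x))"
    using norm_blinfun[of B "B x"] assms(2)
    by (intro mult_left_mono) (auto intro: order_trans[OF _ mult_right_mono])
  finally have "0 \<le> Re (cinner x (B x)) - 2 * s * (norm (B x))\<^sup>2 + s\<^sup>2 * (norm (B x) * (b * norm (B x)))"
    using \<open>s > 0\<close> by simp
  also have "s\<^sup>2 * (norm (B x) * (b * norm (B x))) = s * (norm (B x))\<^sup>2"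
    using \<open>0 < b\<close> by (simp add: s_def power2_eq_square)
  finally have "s * (norm (B x))\<^sup>2 \<le> Re (cinner x (B x))"
    by simp
  then show ?thesis
    using \<open>0 < b\<close> by (simp add: s_def field_simps)
qed

text \<open>
  If the form of \<open>p(T)\<close> took negative values, let \<open>l < 0\<close> be its infimum on the unit sphere.
  Then \<open>p - l\<close> has no zero on the spectrum, so \<open>p(T) - l\<close> is invertible; but it is nonnegative
  with infimum zero, hence not bounded below.  As \<open>p\<close> is not constant, \<open>p - l\<close> is not the zero polynomial.
\<close>

lemma nonconstant_poly_op_nonneg:
  assumes T: "self_adjoint T" and "degree p > 0" and p: "\<And>r. r \<in> spec T \<Longrightarrow> 0 \<le> poly p r"
  shows "0 \<preceq> poly_op p T"
proof (rule ccontr)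
  assume neg: "\<not> 0 \<preceq> poly_op p T"
  define S where "S = poly_op p T"
  have S: "self_adjoint S"
    using T by (simp add: S_def self_adjoint_poly_op)
  obtain x where x: "Re (cinner x (S x)) < 0"
    using neg S by (auto simp: zero_loewner_le_iff S_def not_le)
  define N where "N = {Re (cinner y (S y)) |y. norm y = 1}"
  define l where "l = Inf N"
  have bdd: "bdd_below N"
  proof (rule bdd_belowI)
    fix r assume "r \<in> N"
    then obtain y where y: "r = Re (cinner y (S y))" "norm y = 1" by (auto simp: N_def)
    have "- r = Re (cinner y (- S y))" by (simp add: y cinner.minus_right)
    also have "\<dots> \<le> norm S"
      using Re_cinner_le[of y "- S y"] norm_blinfun[of S y] y by simp
    finally show "- norm S \<le> r" by simp
  qed
  have form: "Re (cinner (r *\<^sub>R y) (S (r *\<^sub>R y))) = r\<^sup>2 * Re (cinner y (S y))" for r y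
    by (simp add: blinfun.scaleR_right cinner.scaleR_left cinner.scaleR_right power2_eq_square)
  have "x \<noteq> 0" using x by (auto simp: cinner.zero_left)
  then have unit: "(1 / norm x)\<^sup>2 * Re (cinner x (S x)) \<in> N"
    unfolding N_def by (intro CollectI exI[of _ "(1 / norm x) *\<^sub>R x"]) (simp add: form)
  have "l \<le> (1 / norm x)\<^sup>2 * Re (cinner x (S x))"
    unfolding l_def using unit bdd by (rule cInf_lower)
  also have "\<dots> < 0"
    using x \<open>x \<noteq> 0\<close> by (simp add: mult_pos_neg)
  finally have "l < 0" .
  define B where "B = S - l *\<^sub>R id_blinfun"
  have B_eq: "B = poly_op (p - [:l:]) T"
    by (simp add: B_def S_def poly_op_diff)
  have B_form: "Re (cinner y (B y)) = Re (cinner y (S y)) - l * (norm y)\<^sup>2" for y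
    by (simp add: B_def blinfun.bilinear_simps cinner.diff_right cinner.scaleR_right Re_cinner_self)
  have "0 \<preceq> B"
    unfolding zero_loewner_le_iff
  proof (intro conjI allI)
    show "self_adjoint B"
      using S by (simp add: B_def self_adjoint_closed)
    fix y
    show "0 \<le> Re (cinner y (B y))"
    proof (cases "y = 0")
      case False
      then have "(1 / norm y)\<^sup>2 * Re (cinner y (S y)) \<in> N"
        unfolding N_def by (intro CollectI exI[of _ "(1 / norm y) *\<^sub>R y"]) (simp add: form)
      then have "l \<le> (1 / norm y)\<^sup>2 * Re (cinner y (S y))"
        unfolding l_def using bdd by (rule cInf_lower)
      then show ?thesis
        using False by (simp add: B_form field_simps power2_eq_square)
    qed (simp add: cinner.zero_left)
  qed
  have "poly (p - [:l:]) r \<noteq> 0" if "r \<in> spec T" for r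
    using p[OF that] \<open>l < 0\<close> by simp
  moreover have "p - [:l:] \<noteq> 0"
    using \<open>degree p > 0\<close> by auto
  ultimately have "invertible_op B"
    unfolding B_eq by (intro invertible_poly_op[OF T])
  then obtain R where R: "\<And>y. blinfun_apply R (B y) = y"
    unfolding invertible_op_def by (metis blinfun_apply_blinfun_compose blinfun_apply_id_blinfun)
  define b where "b = norm B + 1"
  define c where "c = norm R + 1"
  have bc: "b > 0" "c > 0" by (simp_all add: b_def c_def add_nonneg_pos)
  have "\<exists>r\<in>N. r < l + 1 / (c\<^sup>2 * b)"
  proof -
    have "Inf N < l + 1 / (c\<^sup>2 * b)" using bc by (simp add: l_def)
    then show ?thesis
      using unit bdd by (subst (asm) cInf_less_iff) auto
  qed
  then obtain y where y: "norm y = 1" "Re (cinner y (S y)) < l + 1 / (c\<^sup>2 * b)"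
    by (auto simp: N_def)
  have "1 = norm (R (B y))" by (simp add: R y)
  also have "\<dots> \<le> c * norm (B y)"
    using norm_blinfun[of R "B y"] by (simp add: c_def distrib_right add_increasing2)
  finally have "1\<^sup>2 \<le> (c * norm (B y))\<^sup>2"
    by (intro power_mono) auto
  also have "\<dots> \<le> c\<^sup>2 * (b * Re (cinner y (B y)))"
    unfolding power_mult_distrib
    by (intro mult_left_mono nonneg_norm_sq_le[OF \<open>0 \<preceq> B\<close>]) (auto simp: b_def add_nonneg_pos)
  also have "\<dots> < c\<^sup>2 * (b * (1 / (c\<^sup>2 * b)))"
    using y bc by (intro mult_strict_left_mono) (auto simp: B_form)
  also have "\<dots> = 1" using bc by simp
  finally show False by simp
qed

text \<open>
  A negative constant is nonnegative on an empty spectrum only.  Then \<open>x - K\<close> is nonnegative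
  there for every \<open>K\<close>, so \<open>T\<close> dominates every multiple of the identity and the space is trivial.
\<close>

lemma poly_op_nonneg:
  assumes T: "self_adjoint T" and p: "\<And>r. r \<in> spec T \<Longrightarrow> 0 \<le> poly p r"
  shows "0 \<preceq> poly_op p T"
proof (cases "degree p = 0")
  case False
  then show ?thesis
    using nonconstant_poly_op_nonneg[OF T] p by blast
next
  case True
  then obtain c where c: "p = [:c:]"
    by (metis degree_eq_zeroE)
  have "0 \<le> c * (norm x)\<^sup>2" for x :: 'a
  proof (cases "0 \<le> c")
    case False
    with p have "r \<notin> spec T" for r by (force simp: c)
    then have "0 \<preceq> poly_op [:- (norm T + 1), 1:] T"
      by (intro nonconstant_poly_op_nonneg[OF T]) auto
    then have "0 \<le> Re (cinner x (T x - (norm T + 1) *\<^sub>R x))"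
      unfolding poly_op_linear by (simp add: zero_loewner_le_iff blinfun.bilinear_simps)
    then have "(norm T + 1) * (norm x)\<^sup>2 \<le> Re (cinner x (T x))"
      by (simp only: cinner.diff_right cinner.scaleR_right) (simp add: Re_cinner_self)
    then have "(norm T + 1) * norm x \<le> norm T * norm x"
      using norm_blinfun[of T x] coercive_norm_le order_trans by blast
    then have "x = 0" by (simp add: distrib_right)
    then show ?thesis by simp
  qed simp
  then show ?thesis
    by (simp add: c zero_loewner_le_iff self_adjoint_closed blinfun.bilinear_simps
        cinner.scaleR_right Re_cinner_self)
qed

section \<open>Functional calculus\<close>

text \<open>
  For \<open>Re z\<close> below \<open>- norm T\<close> the operator \<open>T - z\<close> is coercive.  The bound makes the
  infimum in \<open>spec_min\<close> a genuine one.
\<close>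

lemma spectrum_Re_ge:
  assumes T: "clinear_op T" and z: "z \<in> spectrum T"
  shows "- norm T \<le> Re z"
proof (rule ccontr)
  assume "\<not> - norm T \<le> Re z"
  then have pos: "0 < - norm T - Re z" by simp
  define B where "B = T - Blinfun (\<lambda>x. z *\<^sub>C x)"
  have B: "B x = T x - z *\<^sub>C x" for x
    by (simp add: B_def blinfun.diff_left bounded_linear_Blinfun_apply scaleC.bounded_linear_right)
  have "invertible_op B"
  proof (rule coercive_imp_invertible_op[OF _ pos])
    show "clinear_op B"
      using T by (simp add: clinear_op_def B scaleC.diff_right scaleC_scaleC mult.commute)
    fix x
    have "- Re (cinner x (T x)) = Re (cinner x (- T x))"
      by (simp add: cinner.minus_right)
    also have "\<dots> \<le> norm x * norm (T x)"
      using Re_cinner_le[of x "- T x"] by simp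
    also have "\<dots> \<le> norm x * (norm T * norm x)"
      by (intro mult_left_mono norm_blinfun) auto
    finally have "- norm T * (norm x)\<^sup>2 \<le> Re (cinner x (T x))"
      by (simp add: power2_eq_square mult_ac)
    moreover have "Re (cinner x (z *\<^sub>C x)) = Re z * (norm x)\<^sup>2"
    proof -
      have "Im (cinner x x) = 0"
        using cinner_commute[of x x] by (simp add: complex_eq_iff)
      then show ?thesis
        by (simp add: cinner_scaleC_right Re_cinner_self)
    qed
    ultimately show "(- norm T - Re z) * (norm x)\<^sup>2 \<le> Re (cinner x (B x))"
      by (simp add: B cinner.diff_right algebra_simps)
  qed
  then show False
    using z unfolding spectrum_def invertible_op_def blinfun_eq_iff by (auto simp: B)
qed

lemma spec_min_le:
  assumes "self_adjoint T" "r \<in> spec T"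
  shows "spec_min T \<le> r"
  unfolding spec_min_def
proof (rule cInf_lower)
  show "r \<in> Re ` spectrum T"
    using assms(2) by force
  show "bdd_below (Re ` spectrum T)"
    using spectrum_Re_ge assms(1) by (intro bdd_belowI[of _ "- norm T"]) (auto simp: self_adjoint_def)
qed

lemma spec_subset_Re_spectrum: "spec T \<subseteq> Re ` spectrum T"
  by force

text \<open>
  Positivity of \<open>c^2 - p(T)^2\<close> says \<open>|p(T) x|^2 \<le> c^2 |x|^2\<close>.
\<close>

lemma norm_poly_op_le:
  assumes T: "self_adjoint T" and "0 \<le> c" and le: "\<And>r. r \<in> spec T \<Longrightarrow> \<bar>poly p r\<bar> \<le> c"
  shows "norm (poly_op p T) \<le> c"
proof (rule norm_blinfun_bound[OF \<open>0 \<le> c\<close>])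
  fix x
  have "0 \<preceq> poly_op ([:c\<^sup>2:] - p * p) T"
  proof (rule poly_op_nonneg[OF T])
    fix r assume "r \<in> spec T"
    then have "(poly p r)\<^sup>2 \<le> c\<^sup>2"
      using le \<open>0 \<le> c\<close> by (simp add: abs_le_square_iff[symmetric])
    then show "0 \<le> poly ([:c\<^sup>2:] - p * p) r"
      by (simp add: power2_eq_square)
  qed
  then have "0 \<le> c\<^sup>2 * (norm x)\<^sup>2 - Re (cinner x (poly_op p T (poly_op p T x)))"
    unfolding poly_op_diff poly_op_mult
    by (simp add: zero_loewner_le_iff blinfun.bilinear_simps cinner.diff_right
        cinner.scaleR_right Re_cinner_self)
  moreover have "cinner x (poly_op p T (poly_op p T x)) = cinner (poly_op p T x) (poly_op p T x)"
    using self_adjoint_poly_op[OF T, of p] by (simp add: self_adjoint_def)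
  ultimately have "(norm (poly_op p T x))\<^sup>2 \<le> (c * norm x)\<^sup>2"
    by (simp add: Re_cinner_self power_mult_distrib)
  then show "norm (poly_op p T x) \<le> c * norm x"
    by (rule power2_le_imp_le) (simp add: \<open>0 \<le> c\<close>)
qed

lemma poly_op_tendsto_zero:
  assumes T: "self_adjoint T"
    and p: "uniform_limit (spec T) (\<lambda>n x. poly (p n) x) (\<lambda>x. 0) sequentially"
  shows "(\<lambda>n. poly_op (p n) T) \<longlonglongrightarrow> 0"
proof (rule tendstoI)
  fix e :: real assume "e > 0"
  then have "\<forall>\<^sub>F n in sequentially. \<forall>x\<in>spec T. dist (poly (p n) x) 0 < e / 2"
    using uniform_limitD[OF p, of "e / 2"] by simp
  then show "\<forall>\<^sub>F n in sequentially. dist (poly_op (p n) T) 0 < e"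
  proof eventually_elim
    case (elim n)
    then have "norm (poly_op (p n) T) \<le> e / 2"
      using \<open>e > 0\<close> by (intro norm_poly_op_le[OF T]) (auto simp: dist_norm intro: less_imp_le)
    then show ?case using \<open>e > 0\<close> by simp
  qed
qed

lemma poly_op_Cauchy:
  assumes T: "self_adjoint T"
    and p: "uniform_limit (spec T) (\<lambda>n x. poly (p n) x) h sequentially"
  shows "Cauchy (\<lambda>n. poly_op (p n) T)"
proof (rule metric_CauchyI)
  fix e :: real assume "e > 0"
  then obtain N where N: "\<And>n x. n \<ge> N \<Longrightarrow> x \<in> spec T \<Longrightarrow> dist (poly (p n) x) (h x) < e / 4"
    using uniform_limitD[OF p, of "e / 4"] by (auto simp: eventually_sequentially)
  have "dist (poly_op (p i) T) (poly_op (p j) T) < e" if "i \<ge> N" "j \<ge> N" for i j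
  proof -
    have "norm (poly_op (p i - p j) T) \<le> e / 2"
    proof (rule norm_poly_op_le[OF T])
      fix x assume "x \<in> spec T"
      with N[OF that(1) this] N[OF that(2) this] show "\<bar>poly (p i - p j) x\<bar> \<le> e / 2"
        unfolding dist_real_def poly_diff by linarith
    qed (use \<open>e > 0\<close> in simp)
    then show ?thesis
      using \<open>e > 0\<close> by (simp add: dist_norm poly_op_diff)
  qed
  then show "\<exists>N. \<forall>m\<ge>N. \<forall>n\<ge>N. dist (poly_op (p m) T) (poly_op (p n) T) < e" by blast
qed

text \<open>
  The definite description in \<open>fun_op\<close> is justified by one approximating sequence: its operators
  converge by completeness, and any other sequence differs from it by polynomials tending to zero
  uniformly on the spectrum.
\<close>

lemma poly_op_tendsto_fun_op:
  assumes T: "self_adjoint T"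
    and p: "uniform_limit (Re ` spectrum T) (\<lambda>n x. poly (p n) x) h sequentially"
  shows "(\<lambda>n. poly_op (p n) T) \<longlonglongrightarrow> fun_op h T"
proof -
  obtain B where B: "(\<lambda>n. poly_op (p n) T) \<longlonglongrightarrow> B"
    using poly_op_Cauchy[OF T uniform_limit_on_subset[OF p spec_subset_Re_spectrum]]
      Cauchy_convergent_iff convergent_def by blast
  have "fun_op h T = B"
    unfolding fun_op_def
  proof (rule the_equality)
    show "\<forall>q. uniform_limit (Re ` spectrum T) (\<lambda>n x. poly (q n) x) h sequentially \<longrightarrow>
        (\<lambda>n. poly_op (q n) T) \<longlonglongrightarrow> B"
    proof (intro allI impI)
      fix q assume q: "uniform_limit (Re ` spectrum T) (\<lambda>n x. poly (q n) x) h sequentially"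
      have "uniform_limit (Re ` spectrum T) (\<lambda>n x. poly (q n) x - poly (p n) x) (\<lambda>x. h x - h x)
          sequentially"
        by (intro uniform_limit_intros q p)
      then have "uniform_limit (Re ` spectrum T) (\<lambda>n x. poly (q n - p n) x) (\<lambda>x. 0) sequentially"
        by simp
      then have "(\<lambda>n. poly_op (q n - p n) T) \<longlonglongrightarrow> 0"
        by (intro poly_op_tendsto_zero[OF T] uniform_limit_on_subset[OF _ spec_subset_Re_spectrum])
      from tendsto_add[OF B this] show "(\<lambda>n. poly_op (q n) T) \<longlonglongrightarrow> B"
        by (simp add: poly_op_diff)
    qed
  next
    fix B' assume "\<forall>q. uniform_limit (Re ` spectrum T) (\<lambda>n x. poly (q n) x) h sequentially \<longrightarrow>
        (\<lambda>n. poly_op (q n) T) \<longlonglongrightarrow> B'"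
    with p B show "B' = B"
      using LIMSEQ_unique by blast
  qed
  with B show ?thesis by simp
qed

lemma weierstrass_poly_uniform_limit:
  fixes h :: "real \<Rightarrow> real"
  assumes "compact X" "continuous_on X h"
  obtains p :: "nat \<Rightarrow> real poly" where "uniform_limit X (\<lambda>n x. poly (p n) x) h sequentially"
proof -
  have "\<exists>p. \<forall>x\<in>X. \<bar>h x - poly p x\<bar> < 1 / real (Suc n)" for n
  proof -
    have "0 < 1 / real (Suc n)" by simp
    then obtain q where q: "real_polynomial_function q" "\<And>x. x \<in> X \<Longrightarrow> \<bar>h x - q x\<bar> < 1 / real (Suc n)"
      using Stone_Weierstrass_real_polynomial_function[OF assms] by blast
    then obtain a d where "q = (\<lambda>x. \<Sum>i\<le>d. a i * x ^ i)"
      using real_polynomial_function_iff_sum by blast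
    then have "q x = poly (\<Sum>i\<le>d. monom (a i) i) x" for x
      by (simp add: poly_sum poly_monom)
    with q(2) show ?thesis by auto
  qed
  then obtain p where p: "\<And>n x. x \<in> X \<Longrightarrow> \<bar>h x - poly (p n) x\<bar> < 1 / real (Suc n)"
    by metis
  have "uniform_limit X (\<lambda>n x. poly (p n) x) h sequentially"
  proof (rule uniform_limitI)
    fix e :: real assume "e > 0"
    then obtain N where N: "1 / real (Suc N) < e"
      using nat_approx_posE by blast
    have "dist (poly (p n) x) (h x) < e" if "n \<ge> N" "x \<in> X" for n x
    proof -
      have "1 / real (Suc n) \<le> 1 / real (Suc N)"
        using that by (simp add: frac_le)
      then show ?thesis
        using p[OF that(2), of n] N by (simp add: dist_real_def abs_minus_commute)
    qed
    then show "\<forall>\<^sub>F n in sequentially. \<forall>x\<in>X. dist (poly (p n) x) (h x) < e"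
      by (auto simp: eventually_sequentially)
  qed
  then show thesis by (rule that)
qed

text \<open>
  The approximants \<open>p n\<close> may be slightly negative on the spectrum.  Adding \<open>e > 0\<close> makes them
  nonnegative for large \<open>n\<close>, and \<open>e\<close> tends to zero after \<open>n\<close> has tended to infinity.
\<close>

lemma loewner_nonneg_of_uniform_limit:
  assumes T: "self_adjoint T"
    and p: "uniform_limit (spec T) (\<lambda>n x. poly (p n) x) h sequentially"
    and h: "\<And>x. x \<in> spec T \<Longrightarrow> 0 \<le> h x"
    and B: "(\<lambda>n. poly_op (p n) T) \<longlonglongrightarrow> B"
  shows "0 \<preceq> B"
proof -
  have shift: "0 \<preceq> B + e *\<^sub>R id_blinfun" if "e > 0" for e
  proof -
    obtain N where N: "\<And>n x. n \<ge> N \<Longrightarrow> x \<in> spec T \<Longrightarrow> dist (poly (p n) x) (h x) < e"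
      using uniform_limitD[OF p \<open>e > 0\<close>] by (auto simp: eventually_sequentially)
    show ?thesis
    proof (rule loewner_nonneg_limit)
      show "0 \<preceq> poly_op (p (n + N)) T + e *\<^sub>R id_blinfun" for n
      proof -
        have "0 \<preceq> poly_op (p (n + N) + [:e:]) T"
        proof (rule poly_op_nonneg[OF T])
          fix x assume x: "x \<in> spec T"
          then show "0 \<le> poly (p (n + N) + [:e:]) x"
            using N[of "n + N" x] h[OF x] by (simp add: dist_real_def abs_less_iff)
        qed
        then show ?thesis by (simp add: poly_op_add)
      qed
      show "(\<lambda>n. poly_op (p (n + N)) T + e *\<^sub>R id_blinfun) \<longlonglongrightarrow> B + e *\<^sub>R id_blinfun"
        by (intro tendsto_intros LIMSEQ_ignore_initial_segment[OF B])
    qed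
  qed
  show ?thesis
  proof (rule loewner_nonneg_limit)
    show "0 \<preceq> B + (1 / real (Suc n)) *\<^sub>R id_blinfun" for n
      by (rule shift) simp
    have "(\<lambda>n. B + (1 / real (Suc n)) *\<^sub>R id_blinfun) \<longlonglongrightarrow> B + 0 *\<^sub>R id_blinfun"
      by (intro tendsto_intros LIMSEQ_Suc[OF lim_1_over_n])
    then show "(\<lambda>n. B + (1 / real (Suc n)) *\<^sub>R id_blinfun) \<longlonglongrightarrow> B" by simp
  qed
qed

lemma uniform_limit_poly_compose:
  fixes h :: "real \<Rightarrow> real"
  assumes p: "uniform_limit X (\<lambda>n x. p n x) h F" and h: "bounded (h ` X)"
  shows "uniform_limit X (\<lambda>n x. poly q (p n x)) (\<lambda>x. poly q (h x)) F"
proof (induction q)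
  case (pCons c q)
  have "compact (closure (h ` X))"
    using h by (simp add: compact_closure)
  then have "compact (poly q ` closure (h ` X))"
    by (intro compact_continuous_image continuous_intros)
  then have "bounded ((\<lambda>x. poly q (h x)) ` X)"
    by (rule bounded_subset[OF compact_imp_bounded]) (auto simp: closure_def)
  then show ?case
    unfolding poly_pCons by (intro uniform_limit_intros uniform_lim_mult p h pCons)
qed (simp add: uniform_limit_const)

text \<open>
  The operator inequalities of the theorem come from instances of this: with \<open>r\<close> a bounding polynomial and \<open>q\<close> the polynomial
  of the map, or with \<open>r\<close> and \<open>q\<close> linear for the comparison of \<open>X\<close> with \<open>g(X)\<close>.
\<close>

lemma loewner_nonneg_poly_fun_op:
  assumes T: "self_adjoint T" and X: "compact X" "spectrum T \<subseteq> complex_of_real ` X"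
    and f: "continuous_on X f"
    and nonneg: "\<And>x. x \<in> spec T \<Longrightarrow> x \<in> X \<Longrightarrow> 0 \<le> poly r x + poly q (f x)"
  shows "0 \<preceq> poly_op r T + poly_op q (fun_op f T)"
proof -
  obtain p :: "nat \<Rightarrow> real poly" where p: "uniform_limit X (\<lambda>n x. poly (p n) x) f sequentially"
    using weierstrass_poly_uniform_limit[OF X(1) f] .
  have sub: "Re ` spectrum T \<subseteq> X" "spec T \<subseteq> X"
    using X(2) by force+
  have bdd: "bounded (f ` X)"
    using X(1) f by (intro compact_imp_bounded compact_continuous_image)
  show ?thesis
  proof (rule loewner_nonneg_of_uniform_limit[OF T])
    have "uniform_limit X (\<lambda>n x. poly r x + poly q (poly (p n) x)) (\<lambda>x. poly r x + poly q (f x))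
        sequentially"
      by (intro uniform_limit_intros uniform_limit_poly_compose p bdd)
    then show "uniform_limit (spec T) (\<lambda>n x. poly (r + pcompose q (p n)) x)
        (\<lambda>x. poly r x + poly q (f x)) sequentially"
      using sub(2) by (simp add: poly_pcompose uniform_limit_on_subset)
    show "(\<lambda>n. poly_op (r + pcompose q (p n)) T) \<longlonglongrightarrow> poly_op r T + poly_op q (fun_op f T)"
      unfolding poly_op_add poly_op_pcompose
      by (intro tendsto_intros tendsto_poly_op poly_op_tendsto_fun_op[OF T]
          uniform_limit_on_subset[OF p sub(1)])
  qed (use nonneg sub in auto)
qed

section \<open>The Kantorovich function and signed power sums\<close>

text \<open>
  Let \<open>i \<ge> 2\<close>.  Up to the factor \<open>M - m\<close>, the chord of \<open>x \<mapsto> x^i\<close> over \<open>[m, M]\<close> is the line \<open>Q x - P\<close>, and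
  \<open>kantorovich m M i\<close> is the maximum of \<open>chord x / x^i\<close> over \<open>x > 0\<close>, attained at \<open>x = 1 / s\<close>.  At
  \<open>x = m\<close> this quotient is \<open>1\<close>; that the value at \<open>1 / s\<close> is at least as large is Bernoulli's
  inequality for \<open>m * s\<close>.
\<close>

lemma kantorovich_ge_1:
  assumes "0 < m" "m < M"
  shows "1 \<le> kantorovich m M (real i)"
proof (cases "i \<le> 1")
  case True
  then show ?thesis by (auto simp: kantorovich_def)
next
  case False
  define P where "P = m * M ^ i - M * m ^ i"
  define Q where "Q = M ^ i - m ^ i"
  define r where "r = real i"
  define s where "s = ((r - 1) * Q) / (r * P)"
  have "r > 1" using False by (simp add: r_def)
  obtain n where n: "i = Suc n" "n > 0"
    using False by (cases i) auto
  have "m ^ n < M ^ n"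
    using assms n by (intro power_strict_mono) auto
  then have "P > 0"
    using assms by (simp add: P_def n mult.left_commute)
  have "Q > 0"
    using power_strict_mono[of m M i] assms n by (simp add: Q_def)
  have "s > 0"
    using \<open>P > 0\<close> \<open>Q > 0\<close> \<open>r > 1\<close> by (simp add: s_def)
  have K: "kantorovich m M (real i) = P / ((r - 1) * (M - m)) * s ^ i"
    using False assms \<open>s > 0\<close>
    by (simp add: kantorovich_def powr_realpow P_def Q_def r_def s_def)
  have "1 + r * (m * s - 1) \<le> (1 + (m * s - 1)) ^ i"
    unfolding r_def using \<open>s > 0\<close> assms by (intro Bernoulli_inequality) simp
  also have "1 + r * (m * s - 1) = (r - 1) * (m * Q - P) / P"
    using \<open>P > 0\<close> \<open>r > 1\<close> by (simp add: s_def field_simps)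
  also have "m * Q - P = m ^ i * (M - m)"
    by (simp add: P_def Q_def algebra_simps)
  finally have "(r - 1) * (m ^ i * (M - m)) / P \<le> m ^ i * s ^ i"
    by (simp add: power_mult_distrib)
  then have "m ^ i * ((r - 1) * (M - m)) \<le> m ^ i * (P * s ^ i)"
    using \<open>P > 0\<close> by (simp add: field_simps)
  then have "(r - 1) * (M - m) \<le> P * s ^ i"
    using assms by simp
  then show ?thesis
    using \<open>r > 1\<close> assms by (simp add: K le_divide_eq_1_pos)
qed

lemma sum_idx_split: "(\<Sum>i=0..I. h i) = (\<Sum>i\<in>idx_pos I a. h i) + (\<Sum>i\<in>idx_neg I a. (h i :: real))"
proof -
  have "{0..I} = idx_pos I a \<union> idx_neg I a" "idx_pos I a \<inter> idx_neg I a = {}"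
    by (auto simp: idx_pos_def idx_neg_def)
  moreover have "finite (idx_pos I a)" "finite (idx_neg I a)"
    by (simp_all add: idx_pos_def idx_neg_def)
  ultimately show ?thesis
    by (simp only: sum.union_disjoint)
qed

text \<open>
  Both \<open>l^i / KL i \<le> y^i\<close> and \<open>y^i \<le> KU i * u^i\<close> hold for every \<open>i\<close>; a negative coefficient exchanges
  their roles.
\<close>

lemma signed_sum_bounds:
  fixes l y u :: real
  assumes "0 < l" "l \<le> y" "y \<le> u" and K: "\<And>i. 1 \<le> KL i" "\<And>i. 1 \<le> KU i"
  shows "(\<Sum>i=0..I. a i * y ^ i) \<le>
      (\<Sum>i\<in>idx_pos I a. a i * KU i * u ^ i) + (\<Sum>i\<in>idx_neg I a. a i * (1 / KL i) * l ^ i)"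
    and "(\<Sum>i\<in>idx_pos I a. a i * (1 / KL i) * l ^ i) + (\<Sum>i\<in>idx_neg I a. a i * KU i * u ^ i) \<le>
      (\<Sum>i=0..I. a i * y ^ i)"
proof -
  have up: "y ^ i \<le> KU i * u ^ i" for i
  proof -
    have "1 * y ^ i \<le> KU i * u ^ i"
      using assms by (intro mult_mono power_mono) (auto intro: order_trans[OF _ K(2)])
    then show ?thesis by simp
  qed
  have low: "(1 / KL i) * l ^ i \<le> y ^ i" for i
  proof -
    have "(1 / KL i) * l ^ i \<le> 1 * y ^ i"
      using assms K(1)[of i] by (intro mult_mono power_mono) (auto simp: divide_le_eq)
    then show ?thesis by simp
  qed
  show "(\<Sum>i=0..I. a i * y ^ i) \<le>
      (\<Sum>i\<in>idx_pos I a. a i * KU i * u ^ i) + (\<Sum>i\<in>idx_neg I a. a i * (1 / KL i) * l ^ i)"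
    unfolding sum_idx_split[of _ I a] mult.assoc
    by (intro add_mono sum_mono mult_left_mono mult_left_mono_neg up low)
       (auto simp: idx_pos_def idx_neg_def)
  show "(\<Sum>i\<in>idx_pos I a. a i * (1 / KL i) * l ^ i) + (\<Sum>i\<in>idx_neg I a. a i * KU i * u ^ i) \<le>
      (\<Sum>i=0..I. a i * y ^ i)"
    unfolding sum_idx_split[of _ I a] mult.assoc
    by (intro add_mono sum_mono mult_left_mono mult_left_mono_neg up low)
       (auto simp: idx_pos_def idx_neg_def)
qed

section \<open>Comparing the map with the bounding polynomials\<close>

lemma Phi_eq_poly_op:
  "Phi I a V X = adj_op V o\<^sub>L poly_op (\<Sum>i=0..I. monom (a i) i) X o\<^sub>L V"
  by (simp add: Phi_def poly_op_sum poly_op_monom)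

text \<open>
  The scalar polynomials behind \<open>Poly_U\<close> and \<open>Poly_L\<close>.  The Kantorovich factors are constants
  taken from the operator, so the latter are polynomials in \<open>A\<close> itself.
\<close>

definition scalar_poly_U where
  "scalar_poly_U I a pL pU A =
     (\<Sum>i\<in>idx_pos I a. smult (a i * K_op pU A i) (pU ^ i)) +
     (\<Sum>i\<in>idx_neg I a. smult (a i * (1 / K_op pL A i)) (pL ^ i))"

definition scalar_poly_L where
  "scalar_poly_L I a pL pU A =
     (\<Sum>i\<in>idx_pos I a. smult (a i * (1 / K_op pL A i)) (pL ^ i)) +
     (\<Sum>i\<in>idx_neg I a. smult (a i * K_op pU A i) (pU ^ i))"

lemma Poly_U_eq_poly_op: "Poly_U I a pL pU A = poly_op (scalar_poly_U I a pL pU A) A"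
  by (simp add: Poly_U_def scalar_poly_U_def poly_op_add poly_op_sum poly_op_smult poly_op_power)

lemma Poly_L_eq_poly_op: "Poly_L I a pL pU A = poly_op (scalar_poly_L I a pL pU A) A"
  by (simp add: Poly_L_def scalar_poly_L_def poly_op_add poly_op_sum poly_op_smult poly_op_power)

lemma compact_Range_U: "compact (Range_U I a pL pU A m M)"
  unfolding Range_U_def by (intro compact_continuous_image continuous_intros compact_Icc)

lemma compact_Range_L: "compact (Range_L I a pL pU A m M)"
  unfolding Range_L_def by (intro compact_continuous_image continuous_intros compact_Icc)

text \<open>
  Nothing but scalar facts on the spectrum of \<open>A\<close> enters: \<open>0 < pL\<close> there because \<open>pL\<close> maps it into
  the spectrum of \<open>pL(A)\<close>, whose infimum is positive, and \<open>pL \<le> f \<le> pU\<close> there because the infimum and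
  the supremum of the spectrum enclose it.
\<close>

lemma Phi_fun_op_bounds:
  fixes A :: "'h::complex_hilbert \<Rightarrow>\<^sub>L 'h" and V :: "'k::complex_hilbert \<Rightarrow>\<^sub>L 'h"
  assumes A: "self_adjoint A" and spec: "spectrum A \<subseteq> complex_of_real ` {m..M}"
    and V: "clinear_op V" and f: "continuous_on {m..M} f"
    and bounds: "\<And>x. x \<in> {spec_min A..spec_max A} \<Longrightarrow> poly pL x \<le> f x \<and> f x \<le> poly pU x"
    and adm_U: "0 < spec_min (poly_op pU A)" "spec_min (poly_op pU A) < spec_max (poly_op pU A)"
    and adm_L: "0 < spec_min (poly_op pL A)" "spec_min (poly_op pL A) < spec_max (poly_op pL A)"
  shows "Phi I a V (fun_op f A) \<preceq> adj_op V o\<^sub>L Poly_U I a pL pU A o\<^sub>L V"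
    and "adj_op V o\<^sub>L Poly_L I a pL pU A o\<^sub>L V \<preceq> Phi I a V (fun_op f A)"
proof -
  let ?q = "\<Sum>i=0..I. monom (a i) i"
  have K: "1 \<le> K_op pL A i" "1 \<le> K_op pU A i" for i
    unfolding K_op_def using adm_U adm_L by (auto intro: kantorovich_ge_1)
  have scalar: "0 < poly pL x \<and> poly pL x \<le> f x \<and> f x \<le> poly pU x" if x: "x \<in> spec A" for x
  proof -
    have "spec_min (poly_op pL A) \<le> poly pL x"
      by (intro spec_min_le self_adjoint_poly_op A poly_in_spec_poly_op x)
    moreover have "x \<le> spec_max A"
      unfolding spec_max_def
    proof (rule cSup_upper)
      show "x \<in> Re ` spectrum A" using x by force
      show "bdd_above (Re ` spectrum A)"
        using spec by (intro bdd_aboveI[of _ M]) auto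
    qed
    ultimately show ?thesis
      using adm_L(1) bounds[of x] spec_min_le[OF A x] by auto
  qed
  have "0 \<preceq> poly_op (scalar_poly_U I a pL pU A) A + poly_op (- ?q) (fun_op f A)"
  proof (rule loewner_nonneg_poly_fun_op[OF A compact_Icc spec f])
    fix x assume "x \<in> spec A"
    with scalar[OF this]
      signed_sum_bounds(1)[where KL = "K_op pL A" and KU = "K_op pU A", OF _ _ _ K,
        where l = "poly pL x" and y = "f x" and u = "poly pU x" and I = I and a = a]
    show "0 \<le> poly (scalar_poly_U I a pL pU A) x + poly (- ?q) (f x)"
      by (simp add: scalar_poly_U_def poly_sum poly_monom)
  qed
  from loewner_nonneg_congruence[OF V this]
  show "Phi I a V (fun_op f A) \<preceq> adj_op V o\<^sub>L Poly_U I a pL pU A o\<^sub>L V"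
    by (subst loewner_le_iff_diff)
       (simp add: Phi_eq_poly_op Poly_U_eq_poly_op poly_op_minus
        blinfun_compose.diff_left blinfun_compose.diff_right)
  have "0 \<preceq> poly_op (- scalar_poly_L I a pL pU A) A + poly_op ?q (fun_op f A)"
  proof (rule loewner_nonneg_poly_fun_op[OF A compact_Icc spec f])
    fix x assume "x \<in> spec A"
    with scalar[OF this]
      signed_sum_bounds(2)[where KL = "K_op pL A" and KU = "K_op pU A", OF _ _ _ K,
        where l = "poly pL x" and y = "f x" and u = "poly pU x" and I = I and a = a]
    show "0 \<le> poly (- scalar_poly_L I a pL pU A) x + poly ?q (f x)"
      by (simp add: scalar_poly_L_def poly_sum poly_monom)
  qed
  from loewner_nonneg_congruence[OF V this]
  show "adj_op V o\<^sub>L Poly_L I a pL pU A o\<^sub>L V \<preceq> Phi I a V (fun_op f A)"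
    by (subst loewner_le_iff_diff)
       (simp add: Phi_eq_poly_op Poly_L_eq_poly_op poly_op_minus
        blinfun_compose.diff_left blinfun_compose.diff_right
        blinfun_compose.minus_left blinfun_compose.minus_right)
qed

lemma fun_op_diff_bounds:
  assumes X: "self_adjoint X" and S: "compact S" "spectrum X \<subseteq> complex_of_real ` S"
    and g: "continuous_on S g"
  shows "X - fun_op g X \<preceq> (SUP x\<in>S. x - g x) *\<^sub>R id_blinfun"
    and "(INF x\<in>S. x - g x) *\<^sub>R id_blinfun \<preceq> X - fun_op g X"
proof -
  have "bounded ((\<lambda>x. x - g x) ` S)"
    using S(1) g by (intro compact_imp_bounded compact_continuous_image continuous_intros)
  then have bdd: "bdd_above ((\<lambda>x. x - g x) ` S)" "bdd_below ((\<lambda>x. x - g x) ` S)"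
    by (simp_all add: bounded_imp_bdd_above bounded_imp_bdd_below)
  let ?c = "SUP x\<in>S. x - g x" and ?d = "INF x\<in>S. x - g x"
  have "0 \<preceq> poly_op [:?c, - 1:] X + poly_op [:0, 1:] (fun_op g X)"
  proof (rule loewner_nonneg_poly_fun_op[OF X S g])
    fix x assume "x \<in> S"
    then show "0 \<le> poly [:?c, - 1:] x + poly [:0, 1:] (g x)"
      using cSUP_upper[OF _ bdd(1), of x] by simp
  qed
  then show "X - fun_op g X \<preceq> ?c *\<^sub>R id_blinfun"
    by (subst loewner_le_iff_diff) (simp add: blinfun_compose.minus_right algebra_simps)
  have "0 \<preceq> poly_op [:- ?d, 1:] X + poly_op [:0, - 1:] (fun_op g X)"
  proof (rule loewner_nonneg_poly_fun_op[OF X S g])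
    fix x assume "x \<in> S"
    then show "0 \<le> poly [:- ?d, 1:] x + poly [:0, - 1:] (g x)"
      using cINF_lower[OF bdd(2), of x] by simp
  qed
  then show "?d *\<^sub>R id_blinfun \<preceq> X - fun_op g X"
    by (subst loewner_le_iff_diff) (simp add: blinfun_compose.minus_right algebra_simps)
qed

theorem theorem4:
  fixes A :: "nat \<Rightarrow> ('h::complex_hilbert \<Rightarrow>\<^sub>L 'h)"
    and V :: "'k::complex_hilbert \<Rightarrow>\<^sub>L 'h"
    and k I :: nat
    and m M w a :: "nat \<Rightarrow> real"
    and f g :: "real \<Rightarrow> real"
    and pL pU :: "real poly"
    and \<epsilon> \<alpha> :: real
    and F :: "real \<Rightarrow> real \<Rightarrow> real"
    and J1 J2 SU SL :: "real set"
    and XU XL :: "'k \<Rightarrow>\<^sub>L 'k"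
  assumes A: "\<forall>j\<in>{1..k}. self_adjoint (A j)"
    and mM: "\<forall>j\<in>{1..k}. m j < M j"
    and spec: "\<forall>j\<in>{1..k}. spectrum (A j) \<subseteq> complex_of_real ` {m j..M j}"
    and w_nonneg: "\<forall>j\<in>{1..k}. 0 \<le> w j"
    and w_sum: "(\<Sum>j=1..k. w j) = 1"
    and V: "isometry_op V"
    and f: "continuous_on (\<Union>j\<in>{1..k}. {m j..M j}) f"
    and eps: "0 < \<epsilon>"
    and upper: "\<forall>j\<in>{1..k}. \<forall>x\<in>{spec_min (A j)..spec_max (A j)}.
                  0 \<le> poly pU x - f x \<and> poly pU x - f x \<le> \<epsilon>"
    and lower: "\<forall>j\<in>{1..k}. \<forall>x\<in>{spec_min (A j)..spec_max (A j)}.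
                  0 \<le> f x - poly pL x \<and> f x - poly pL x \<le> \<epsilon>"
    and admissible_U: "\<forall>j\<in>{1..k}. 0 < spec_min (poly_op pU (A j)) \<and>
                  spec_min (poly_op pU (A j)) < spec_max (poly_op pU (A j))"
    and admissible_L: "\<forall>j\<in>{1..k}. 0 < spec_min (poly_op pL (A j)) \<and>
                  spec_min (poly_op pL (A j)) < spec_max (poly_op pL (A j))"
    and SU: "SU = (\<Union>j\<in>{1..k}. (\<lambda>x. w j * x) ` Range_U I a pL pU (A j) (m j) (M j))"
    and SL: "SL = (\<Union>j\<in>{1..k}. (\<lambda>x. w j * x) ` Range_L I a pL pU (A j) (m j) (M j))"
    and g: "continuous_on (SL \<union> SU) g"
    and F: "\<forall>u\<in>J1. \<forall>v\<in>J2. F u v = u - \<alpha> * v"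
    and J1: "f ` (\<Union>j\<in>{1..k}. {m j..M j}) \<subseteq> J1"
    and J2: "g ` (SL \<union> SU) \<subseteq> J2"
    and XU: "XU = (\<Sum>j=1..k. w j *\<^sub>R (adj_op V o\<^sub>L Poly_U I a pL pU (A j) o\<^sub>L V))"
    and XL: "XL = (\<Sum>j=1..k. w j *\<^sub>R (adj_op V o\<^sub>L Poly_L I a pL pU (A j) o\<^sub>L V))"
  shows "(spectrum XU \<subseteq> complex_of_real ` SU \<longrightarrow>
           (\<Sum>j=1..k. w j *\<^sub>R Phi I a V (fun_op f (A j))) - fun_op g XU
             \<preceq> (SUP x\<in>SU. x - g x) *\<^sub>R id_blinfun) \<and>
         (spectrum XL \<subseteq> complex_of_real ` SL \<longrightarrow>
           (INF x\<in>SL. x - g x) *\<^sub>R id_blinfun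
             \<preceq> (\<Sum>j=1..k. w j *\<^sub>R Phi I a V (fun_op f (A j))) - fun_op g XL)"
proof -
  have clV: "clinear_op V"
    using V by (simp add: isometry_op_def)
  let ?Y = "\<Sum>j=1..k. w j *\<^sub>R Phi I a V (fun_op f (A j))"
  have bounds: "Phi I a V (fun_op f (A j)) \<preceq> adj_op V o\<^sub>L Poly_U I a pL pU (A j) o\<^sub>L V"
      "adj_op V o\<^sub>L Poly_L I a pL pU (A j) o\<^sub>L V \<preceq> Phi I a V (fun_op f (A j))"
    if j: "j \<in> {1..k}" for j
  proof -
    have "continuous_on {m j..M j} f"
      using f by (rule continuous_on_subset) (use j in auto)
    moreover have "poly pL x \<le> f x \<and> f x \<le> poly pU x" if "x \<in> {spec_min (A j)..spec_max (A j)}" for x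
      using upper lower j that by (metis diff_ge_0_iff_ge)
    ultimately show "Phi I a V (fun_op f (A j)) \<preceq> adj_op V o\<^sub>L Poly_U I a pL pU (A j) o\<^sub>L V"
      "adj_op V o\<^sub>L Poly_L I a pL pU (A j) o\<^sub>L V \<preceq> Phi I a V (fun_op f (A j))"
      using j A spec clV admissible_U admissible_L
      by (intro Phi_fun_op_bounds[where A = "A j" and m = "m j" and M = "M j"]; auto)+
  qed
  have sa: "self_adjoint XU" "self_adjoint XL"
    unfolding XU XL Poly_U_eq_poly_op Poly_L_eq_poly_op using A clV
    by (auto intro!: self_adjoint_sum self_adjoint_closed(5) self_adjoint_congruence self_adjoint_poly_op)
  have cpt: "compact SU" "compact SL"
    unfolding SU SL
    by (intro compact_UN finite_atLeastAtMost compact_continuous_image continuous_intros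
        compact_Range_U compact_Range_L)+
  have cont: "continuous_on SU g" "continuous_on SL g"
    using g by (auto intro: continuous_on_subset)
  show ?thesis
  proof (intro conjI impI)
    assume "spectrum XU \<subseteq> complex_of_real ` SU"
    then have "XU - fun_op g XU \<preceq> (SUP x\<in>SU. x - g x) *\<^sub>R id_blinfun"
      by (rule fun_op_diff_bounds(1)[OF sa(1) cpt(1) _ cont(1)])
    moreover have "?Y \<preceq> XU"
      unfolding XU using w_nonneg bounds by (intro loewner_sum_mono) auto
    then have "?Y - fun_op g XU \<preceq> XU - fun_op g XU"
      using loewner_add_right[of _ _ "- fun_op g XU"] by simp
    ultimately show "?Y - fun_op g XU \<preceq> (SUP x\<in>SU. x - g x) *\<^sub>R id_blinfun"
      by (rule loewner_le_trans[rotated])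
  next
    assume "spectrum XL \<subseteq> complex_of_real ` SL"
    then have "(INF x\<in>SL. x - g x) *\<^sub>R id_blinfun \<preceq> XL - fun_op g XL"
      by (rule fun_op_diff_bounds(2)[OF sa(2) cpt(2) _ cont(2)])
    moreover have "XL \<preceq> ?Y"
      unfolding XL using w_nonneg bounds by (intro loewner_sum_mono) auto
    then have "XL - fun_op g XL \<preceq> ?Y - fun_op g XL"
      using loewner_add_right[of _ _ "- fun_op g XL"] by simp
    ultimately show "(INF x\<in>SL. x - g x) *\<^sub>R id_blinfun \<preceq> ?Y - fun_op g XL"
      by (rule loewner_le_trans)
  qed
qed

end
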